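(* Let $n\ge 3$ and let $X_1,\ldots,X_n$ be i.i.d. real random variables with distribution $F$, where $F$ has a density $f_X$ that is positive and continuous on all of $\mathbb R$. Let $X_{(1)}\le\cdots\le X_{(n)}$ be the order statistics and $\overline X_n=\frac1n\sum_{i=1}^nX_i$ the sample mean. Let $p>0$, let $U:\mathbf A\to\mathbb R$ be a feasible definite base function on $\mathbf A$ with positive degree $p$ of homogeneity, and let $$Z_n=U\big(X_{(1)}-\overline X_n,\,X_{(2)}-\overline X_n,\ldots,X_{(n)}-\overline X_n\big)$$ be the corresponding feasible definite statistic. Then $\overline X_n$ and $Z_n$ are independent if and only if $F$ is a normal distribution.
   Context: $\mathbf A=\{(\lambda_1,\ldots,\lambda_n)\in\mathbb R^n:\ \lambda_1\le\lambda_2\le\cdots\le\lambda_n,\ \sum_{i=1}^n\lambda_i=0\}$. A function $U:\mathbf A\to\mathbb R$ is called feasible definite with positive degree $p$ of homogeneity ($p>0$) if: (i) $U$ is nonnegative and continuous on $\mathbf A$; (ii) for $(\lambda_1,\ldots,\lambda_n)\in\mathbf A$, $U(\lambda_1,\ldots,\lambda_n)=0$ if and only if $(\lambda_1,\ldots,\lambda_n)=(0,\ldots,0)$; (iii) $U(s\lambda_1,\ldots,s\lambda_n)=s^pU(\lambda_1,\ldots,\lambda_n)$ for all $s>0$ and all $(\lambda_1,\ldots,\lambda_n)\in\mathbf A$. The statistic $Z_n$ defined from such a $U$ is called a feasible definite statistic on $\mathbf A$ with positive degree $p$ of homogeneity. "$F$ is normal" means $F=N(\mu,\sigma^2)$ for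 some $\mu\in\mathbb R$, $\sigma>0$. *)

theory Defs
  imports "HOL-Probability.Probability"
begin

text \<open>
  Vectors of \<open>\<real>\<^sup>n\<close> are functions \<open>nat \<Rightarrow> real\<close> that are \<^const>\<open>extensional\<close> on \<open>{1..n}\<close>,
  i.e. \<^const>\<open>undefined\<close> outside of it. On this set the product topology of the type
  \<open>nat \<Rightarrow> real\<close> is the usual topology of \<open>\<real>\<^sup>n\<close>, so \<^const>\<open>continuous_on\<close> below is
  ordinary continuity.
\<close>

definition ordered_zero_sum :: "nat \<Rightarrow> (nat \<Rightarrow> real) set" where
  "ordered_zero_sum n =
     {v \<in> extensional {1..n}. mono_on {1..n} v \<and> (\<Sum>i = 1..n. v i) = 0}"

definition feasible_definite :: "nat \<Rightarrow> real \<Rightarrow> ((nat \<Rightarrow> real) \<Rightarrow> real) \<Rightarrow> bool" where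
  "feasible_definite n p U \<longleftrightarrow>
     0 < p \<and>
     (\<forall>v \<in> ordered_zero_sum n. 0 \<le> U v) \<and>
     continuous_on (ordered_zero_sum n) U \<and>
     (\<forall>v \<in> ordered_zero_sum n. U v = 0 \<longleftrightarrow> (\<forall>i \<in> {1..n}. v i = 0)) \<and>
     (\<forall>s > 0. \<forall>v \<in> ordered_zero_sum n. U (\<lambda>i \<in> {1..n}. s * v i) = s powr p * U v)"

definition sample_mean :: "nat \<Rightarrow> (nat \<Rightarrow> real) \<Rightarrow> real" where
  "sample_mean n x = (\<Sum>i = 1..n. x i) / real n"

text \<open>The \<open>k\<close>-th smallest of \<open>x 1, \<dots>, x n\<close>, for \<open>1 \<le> k \<le> n\<close> (list positions start at \<open>0\<close>).\<close>

definition order_stat :: "nat \<Rightarrow> (nat \<Rightarrow> real) \<Rightarrow> nat \<Rightarrow> real" where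
  "order_stat n x k = sort (map x [1..<Suc n]) ! (k - 1)"

definition base_statistic :: "nat \<Rightarrow> ((nat \<Rightarrow> real) \<Rightarrow> real) \<Rightarrow> (nat \<Rightarrow> real) \<Rightarrow> real" where
  "base_statistic n U x = U (\<lambda>k \<in> {1..n}. order_stat n x k - sample_mean n x)"

definition is_normal_distribution :: "real measure \<Rightarrow> bool" where
  "is_normal_distribution F \<longleftrightarrow>
     (\<exists>\<mu> \<sigma>. 0 < \<sigma> \<and> F = density lborel (\<lambda>x. ennreal (normal_density \<mu> \<sigma> x)))"

end

theory Submission
  imports Defs
begin

text \<open>
  Proof idea. Write \<open>W\<close> for the sum of squared deviations from the sample mean. By homogeneity and
  compactness \<open>Z\<close> is squeezed between multiples of \<open>W powr (p / 2)\<close>, so fixing the range of \<open>Z\<close> confines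
  the sample to a thin shell around the diagonal; and \<open>Z\<close> is invariant under translations
  along the diagonal.

  If the density is normal, it factors into a function of the mean times a translation invariant
  function, and a Fubini argument on the diagonal translations gives independence.

  Conversely, independence makes the ratio of the probabilities that the mean lies in \<open>(m0, m0 + \<delta>)\<close>
  respectively \<open>(m1, m1 + \<delta>)\<close> insensitive to conditioning on \<open>Z\<close>. Conditioning on ever thinner shells
  shows that it tends to \<open>(f m0 / f m1) ^ n\<close> as \<open>\<delta>\<close> tends to \<open>0\<close>. If \<open>ln f\<close> is touched from above at \<open>m0\<close> by
  a parabola of curvature \<open>k\<close> and from below at \<open>m1\<close> by one of curvature \<open>k' > k\<close>, conditioning
  on a fixed shell makes it smaller than that by a factor bounded away from \<open>1\<close>, a contradiction.
  Hence curvatures touching from below never exceed curvatures touching from above, and a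
  continuous function with this property is a quadratic polynomial. No differentiability of \<open>f\<close>
  is needed.
\<close>

section \<open>Continuous functions touched by parabolas\<close>

text \<open>Subtract from \<open>g\<close> the linear function with the slope of the chord over
  \<open>{a..b}\<close>. An interior maximum of the difference would give a line touching
  \<open>g\<close> from above, which is excluded; so the maximum sits at an endpoint, and the two
  endpoint values agree.\<close>

lemma convex_on_if_no_upper_touch:
  fixes g :: "real \<Rightarrow> real"
  assumes cont: "continuous_on UNIV g"
    and no_touch: "\<And>m b h. 0 < h \<Longrightarrow> \<exists>t. \<bar>t\<bar> \<le> h \<and> g (m + t) > g m + b * t"
  shows "convex_on UNIV g"
proof (rule convex_on_linorderI)
  fix s a b :: real
  assume s: "0 < s" "s < 1" and ab: "a < b"
  define k where "k = (g b - g a) / (b - a)"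
  define d where "d = (\<lambda>t. g t - k * t)"
  have "continuous_on {a..b} d"
    unfolding d_def by (intro continuous_intros continuous_on_subset[OF cont]) auto
  then obtain m where m: "m \<in> {a..b}" "\<And>t. t \<in> {a..b} \<Longrightarrow> d t \<le> d m"
    using continuous_attains_sup[of "{a..b}" d] ab by auto
  have "m = a \<or> m = b"
  proof (rule ccontr)
    assume "\<not> (m = a \<or> m = b)"
    then have h: "0 < min (m - a) (b - m)"
      using m(1) by auto
    from no_touch[OF h, of m k] obtain t
      where t: "\<bar>t\<bar> \<le> min (m - a) (b - m)" "g (m + t) > g m + k * t"
      by blast
    have "d (m + t) \<le> d m"
      using t(1) by (intro m(2)) auto
    then show False
      using t(2) by (simp add: d_def algebra_simps)
  qed
  moreover have dab: "d a = d b"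
    using ab by (simp add: d_def k_def field_simps)
  moreover have "(1 - s) * a + s * b \<in> {a..b}"
    using convex_bound_le[of a b b "1 - s" s] convex_bound_le[of "-a" "-a" "-b" "1 - s" s] s ab
    by (auto simp: algebra_simps)
  ultimately have "d ((1 - s) * a + s * b) \<le> d a"
    using m(2) by metis
  moreover have "d ((1 - s) * a + s * b) = g ((1 - s) * a + s * b) - ((1 - s) * (k * a) + s * (k * b))"
    by (simp add: d_def algebra_simps)
  moreover have "g a = d a + k * a" "g b = d a + k * b"
    using dab by (auto simp: d_def)
  ultimately show "g ((1 - s) *\<^sub>R a + s *\<^sub>R b) \<le> (1 - s) * g a + s * g b"
    by (simp add: algebra_simps)
qed auto

text \<open>A substitute for a bound on the second derivative at some point: for smooth
  \<open>l\<close>, touching at \<open>m\<close> implies that the second derivative at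
  \<open>m\<close> is at most \<open>k\<close>. Touching from below with curvature \<open>k'\<close>
  is expressed by negating both \<open>l\<close> and \<open>k'\<close>.\<close>

definition touch_above :: "(real \<Rightarrow> real) \<Rightarrow> real \<Rightarrow> bool" where
  "touch_above l k \<longleftrightarrow>
     (\<exists>m b h. 0 < h \<and> (\<forall>t. \<bar>t\<bar> \<le> h \<longrightarrow> l (m + t) \<le> l m + b * t + k / 2 * t\<^sup>2))"

lemma convex_on_if_not_touch_above:
  fixes l :: "real \<Rightarrow> real"
  assumes cont: "continuous_on UNIV l" and no_touch: "\<not> touch_above l k"
  shows "convex_on UNIV (\<lambda>t. l t - k / 2 * t\<^sup>2)"
proof (rule convex_on_if_no_upper_touch)
  show "continuous_on UNIV (\<lambda>t. l t - k / 2 * t\<^sup>2)"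
    by (intro continuous_intros cont)
  fix m b h :: real
  assume "0 < h"
  \<comment> \<open>The slope \<open>b + k * m\<close> absorbs the linear term that appears when the
    parabola is expanded around \<open>m\<close>.\<close>
  with no_touch obtain t where "\<bar>t\<bar> \<le> h" "l (m + t) > l m + (b + k * m) * t + k / 2 * t\<^sup>2"
    unfolding touch_above_def by (meson not_le)
  then show "\<exists>t. \<bar>t\<bar> \<le> h \<and> l (m + t) - k / 2 * (m + t)\<^sup>2 > l m - k / 2 * m\<^sup>2 + b * t"
    by (intro exI[of _ t]) (auto simp: power2_eq_square algebra_simps add_divide_distrib)
qed

text \<open>Otherwise subtracting any parabola centred at 0 leaves a convex function, and the
  midpoint inequality at -1, 0, 1 would bound every real \<open>k\<close> by the second difference
  of \<open>l\<close>.\<close>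

lemma ex_touch_above:
  fixes l :: "real \<Rightarrow> real"
  assumes cont: "continuous_on UNIV l"
  shows "\<exists>k. touch_above l k"
proof (rule ccontr)
  assume "\<not> ?thesis"
  then have conv: "convex_on UNIV (\<lambda>t. l t - k / 2 * t\<^sup>2)" for k
    using convex_on_if_not_touch_above[OF cont] by blast
  have "l 0 \<le> (l (-1) + l 1) / 2 - k / 2" for k
    using convex_onD[OF conv[of k], of "1/2" "-1" 1] by (simp add: field_simps)
  from this[of "l (-1) + l 1 - 2 * l 0 + 1"] show False
    by (simp add: field_simps)
qed

text \<open>Let \<open>k\<close> be the supremum of the curvatures touching from below. Removing a
  parabola of curvature \<open>c\<close> leaves a convex function for \<open>c < k\<close> and a
  concave one for \<open>c > k\<close>; in the limit it is both, hence affine.\<close>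

lemma quadratic_if_touch_ordered:
  fixes l :: "real \<Rightarrow> real"
  assumes cont: "continuous_on UNIV l"
    and ordered: "\<And>k k'. touch_above l k \<Longrightarrow> touch_above (\<lambda>t. - l t) (- k') \<Longrightarrow> k' \<le> k"
  shows "\<exists>a b k. \<forall>t. l t = a + b * t + k / 2 * t\<^sup>2"
proof -
  let ?D = "{k'. touch_above (\<lambda>t. - l t) (- k')}"
  define k where "k = Sup ?D"
  have cont': "continuous_on UNIV (\<lambda>t. - l t)"
    by (intro continuous_intros cont)
  obtain k0 where k0: "touch_above l k0"
    using ex_touch_above[OF cont] by blast
  obtain k1 where "touch_above (\<lambda>t. - l t) k1"
    using ex_touch_above[OF cont'] by blast
  then have "- k1 \<in> ?D"
    by simp
  then have ne: "?D \<noteq> {}"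
    by blast
  have bdd: "bdd_above ?D"
    using ordered[OF k0] by (intro bdd_aboveI) auto
  have above: "\<not> touch_above (\<lambda>t. - l t) (- c)" if "k < c" for c
    using cSup_upper[OF _ bdd, of c] that unfolding k_def by auto
  have below: "\<not> touch_above l c" if "c < k" for c
    using cSup_least[OF ne, of c] ordered[of c] that unfolding k_def by fastforce
  have eq: "l ((1 - s) * x + s * y) - k / 2 * ((1 - s) * x + s * y)\<^sup>2
      = (1 - s) * (l x - k / 2 * x\<^sup>2) + s * (l y - k / 2 * y\<^sup>2)"
    if s: "0 \<le> s" "s \<le> 1" for s x y
  proof -
    \<comment> \<open>\<open>\<Phi> c\<close> is the convexity defect at fixed \<open>s\<close>,
      \<open>x\<close>, \<open>y\<close>. It is continuous in \<open>c\<close>, nonnegative below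
      \<open>k\<close> and nonpositive above, so it vanishes at \<open>k\<close>.\<close>
    define \<Phi> where "\<Phi> = (\<lambda>c. (1 - s) * (l x - c / 2 * x\<^sup>2) + s * (l y - c / 2 * y\<^sup>2)
        - (l ((1 - s) * x + s * y) - c / 2 * ((1 - s) * x + s * y)\<^sup>2))"
    have lim: "(\<Phi> \<longlongrightarrow> \<Phi> k) (at k within A)" for A
      unfolding \<Phi>_def by (intro tendsto_intros) auto
    have "0 \<le> \<Phi> c" if "c < k" for c
      using convex_onD[OF convex_on_if_not_touch_above[OF cont below[OF that]], of s x y] s
      by (simp add: \<Phi>_def)
    then have "0 \<le> \<Phi> k"
      by (intro tendsto_lowerbound[OF lim[of "{..<k}"]]) (auto simp: eventually_at_filter trivial_limit_at_left_real)
    moreover have "\<Phi> c \<le> 0" if "k < c" for c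
      using convex_onD[OF convex_on_if_not_touch_above[OF cont' above[OF that]], of s x y] s
      by (simp add: \<Phi>_def algebra_simps)
    then have "\<Phi> k \<le> 0"
      by (intro tendsto_upperbound[OF lim[of "{k<..}"]]) (auto simp: eventually_at_filter trivial_limit_at_right_real)
    ultimately show ?thesis
      by (simp add: \<Phi>_def)
  qed
  define g where "g = (\<lambda>t. l t - k / 2 * t\<^sup>2)"
  have aff: "g ((1 - s) * x + s * y) = (1 - s) * g x + s * g y" if "0 \<le> s" "s \<le> 1" for s x y
    using eq[OF that] by (simp add: g_def)
  \<comment> \<open>The identity \<open>aff\<close> covers convex combinations, so each case takes
    as intermediate point the middle one among 0, 1 and \<open>t\<close>.\<close>
  have lin: "g t = g 0 + (g 1 - g 0) * t" for t
  proof -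
    consider "0 \<le> t" "t \<le> 1" | "1 < t" | "t < 0"
      by linarith
    then show ?thesis
    proof cases
      case 1
      then show ?thesis
        using aff[of t 0 1] by (simp add: algebra_simps)
    next
      case 2
      then show ?thesis
        using aff[of "1 / t" 0 t] by (simp add: field_simps)
    next
      case 3
      define s where "s = - t / (1 - t)"
      have s: "0 \<le> s" "s \<le> 1" and st: "s * (1 - t) = - t"
        using 3 by (auto simp: s_def field_simps)
      have "(1 - s) * t + s * 1 = 0"
        using st by (simp add: algebra_simps)
      then have "g 0 = (1 - s) * g t + s * g 1"
        using aff[OF s, of t 1] by simp
      then have "g 0 * (1 - t) = ((1 - s) * g t + s * g 1) * (1 - t)"
        by simp
      also have "\<dots> = (1 - t - s * (1 - t)) * g t + s * (1 - t) * g 1"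
        by (simp add: algebra_simps)
      finally show ?thesis
        unfolding st by (simp add: algebra_simps)
    qed
  qed
  have "l t = g 0 + (g 1 - g 0) * t + k / 2 * t\<^sup>2" for t
    using lin[of t] by (simp add: g_def)
  then show ?thesis
    by blast
qed

text \<open>Finite total mass forces \<open>k < 0\<close>; completing the square then gives a
  multiple of a normal density, and mass one makes the factor 1.\<close>

lemma normal_if_log_quadratic:
  fixes f :: "real \<Rightarrow> real"
  assumes prob: "prob_space (density lborel (\<lambda>x. ennreal (f x)))"
    and f: "\<And>x. f x = exp (a + b * x + k / 2 * x\<^sup>2)"
  shows "is_normal_distribution (density lborel (\<lambda>x. ennreal (f x)))"
proof -
  have meas [measurable]: "f \<in> borel_measurable borel"
    unfolding f[abs_def] by measurable
  have total: "(\<integral>\<^sup>+x. ennreal (f x) \<partial>lborel) = 1"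
    using prob_space.emeasure_space_1[OF prob] by (simp add: emeasure_density)
  have "k < 0"
  proof (rule ccontr)
    assume "\<not> k < 0"
    then have ge: "f x \<ge> exp (a + b * x)" for x
      unfolding f by simp
    \<comment> \<open>The half-line on which the linear term is nonnegative: there \<open>f\<close>
      is at least \<open>exp a\<close>, yet \<open>H\<close> has infinite length.\<close>
    define H where "H = (if b \<ge> 0 then {0..} else {..0::real})"
    have [measurable]: "H \<in> sets borel"
      by (simp add: H_def)
    have "b * x \<ge> 0" if "x \<in> H" for x
      using that by (auto simp: H_def mult_nonpos_nonpos split: if_splits)
    then have "exp a \<le> f x" if "x \<in> H" for x
      using ge[of x] that by (smt (verit) exp_le_cancel_iff)
    then have "(\<integral>\<^sup>+x. ennreal (exp a) * indicator H x \<partial>lborel) \<le> 1"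
      unfolding total[symmetric]
      by (intro nn_integral_mono) (auto simp: indicator_def intro: ennreal_leI)
    moreover have "emeasure lborel H = \<infinity>"
    proof (rule ccontr)
      assume "\<not> ?thesis"
      then obtain m :: nat where m: "emeasure lborel H < of_nat m"
        using ennreal_Ex_less_of_nat[of "emeasure lborel H"] by (auto simp: less_top)
      have "of_nat m = emeasure lborel (if b \<ge> 0 then {0..real m} else {- real m..0})"
        by (simp add: ennreal_of_nat_eq_real_of_nat)
      also have "\<dots> \<le> emeasure lborel H"
        by (intro emeasure_mono) (auto simp: H_def)
      finally show False
        using m by simp
    qed
    ultimately show False
      by (simp add: nn_integral_cmult ennreal_mult_top top_unique)
  qed
  define \<sigma> where "\<sigma> = sqrt (- 1 / k)"
  define \<mu> where "\<mu> = - b / k"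
  define C where "C = exp (a + \<mu>\<^sup>2 / (2 * \<sigma>\<^sup>2)) * sqrt (2 * pi * \<sigma>\<^sup>2)"
  have "- 1 / k > 0"
    using \<open>k < 0\<close> by (simp add: zero_less_divide_iff)
  then have \<sigma>: "\<sigma> > 0" "\<sigma>\<^sup>2 = - 1 / k"
    unfolding \<sigma>_def by (auto simp only: real_sqrt_gt_zero real_sqrt_pow2 less_imp_le)
  have fC: "f x = C * normal_density \<mu> \<sigma> x" for x
  proof -
    have "a + b * x + k / 2 * x\<^sup>2 = a + \<mu>\<^sup>2 / (2 * \<sigma>\<^sup>2) + (- (x - \<mu>)\<^sup>2 / (2 * \<sigma>\<^sup>2))"
      unfolding \<sigma>(2) \<mu>_def using \<open>k < 0\<close> by (simp add: field_simps power2_eq_square)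
    then show ?thesis
      using \<sigma>(1) by (simp add: f C_def normal_density_def flip: exp_add)
  qed
  have "1 = (\<integral>\<^sup>+x. ennreal C * ennreal (normal_density \<mu> \<sigma> x) \<partial>lborel)"
    unfolding total[symmetric] fC by (simp add: C_def ennreal_mult)
  also have "\<dots> = ennreal C * emeasure (density lborel (\<lambda>x. ennreal (normal_density \<mu> \<sigma> x))) UNIV"
    by (simp add: nn_integral_cmult emeasure_density)
  also have "\<dots> = ennreal C"
    using prob_space.emeasure_space_1[OF prob_space_normal_density[OF \<sigma>(1), of \<mu>]] by simp
  finally have "C = 1"
    by (metis ennreal_eq_1)
  then have "f = normal_density \<mu> \<sigma>"
    by (auto simp: fC)
  then show ?thesis
    unfolding is_normal_distribution_def using \<sigma>(1) by auto
qed

declare One_nat_def [simp del] upt_Suc [simp del]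

section \<open>Diagonal translations of a sample\<close>

definition sq_dev :: "nat \<Rightarrow> (nat \<Rightarrow> real) \<Rightarrow> real" where
  "sq_dev n x = (\<Sum>i = 1..n. (x i - sample_mean n x)\<^sup>2)"

text \<open>The restriction to \<open>{1..n}\<close> keeps the result in the space of
  \<open>leb n\<close>, whose points are extensional.\<close>

definition translate :: "nat \<Rightarrow> real \<Rightarrow> (nat \<Rightarrow> real) \<Rightarrow> nat \<Rightarrow> real" where
  "translate n c x = (\<lambda>i\<in>{1..n}. x i + c)"

abbreviation leb :: "nat \<Rightarrow> (nat \<Rightarrow> real) measure" where
  "leb n \<equiv> PiM {1..n} (\<lambda>_. lborel)"

definition iid_sample :: "nat \<Rightarrow> (real \<Rightarrow> real) \<Rightarrow> (nat \<Rightarrow> real) measure" where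
  "iid_sample n f = density (leb n) (\<lambda>x. ennreal (\<Prod>i = 1..n. f (x i)))"

interpretation lborel_product: product_sigma_finite "\<lambda>_::nat. lborel :: real measure"
  by standard

lemma sets_iid_sample [measurable_cong]: "sets (iid_sample n f) = sets (PiM {1..n} (\<lambda>_. borel))"
  unfolding iid_sample_def by (simp cong: sets_PiM_cong)

lemma space_iid_sample: "space (iid_sample n f) = extensional {1..n}"
  unfolding iid_sample_def by (simp add: space_PiM PiE_UNIV_domain PiE_def)

lemma sample_mean_measurable [measurable]:
  "sample_mean n \<in> borel_measurable (PiM {1..n} (\<lambda>_. borel))"
  unfolding sample_mean_def[abs_def] by measurable

lemma sq_dev_measurable [measurable]:
  "sq_dev n \<in> borel_measurable (PiM {1..n} (\<lambda>_. borel))"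
  unfolding sq_dev_def[abs_def] by measurable

lemma translate_measurable [measurable]: "translate n c \<in> leb n \<rightarrow>\<^sub>M leb n"
  unfolding translate_def[abs_def] by measurable

lemma sample_mean_translate: "n > 0 \<Longrightarrow> sample_mean n (translate n c x) = sample_mean n x + c"
  by (simp add: sample_mean_def translate_def sum.distrib field_simps)

lemma sq_dev_translate: "n > 0 \<Longrightarrow> sq_dev n (translate n c x) = sq_dev n x"
  unfolding sq_dev_def sample_mean_translate by (simp add: translate_def)

text \<open>Boxes determine the product measure, and the preimage of a box is a box whose sides are
  translates of the original ones.\<close>

lemma distr_leb_translate: "distr (leb n) (leb n) (translate n c) = leb n"
proof (rule lborel_product.PiM_eqI)
  fix A :: "nat \<Rightarrow> real set"
  assume A: "\<And>i. i \<in> {1..n} \<Longrightarrow> A i \<in> sets lborel"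
  have pre: "emeasure lborel ((\<lambda>x. x + c) -` A i) = emeasure lborel (A i)" if "i \<in> {1..n}" for i
    using emeasure_distr[of "(+) c" lborel borel "A i"] A[OF that] lborel_distr_plus[of c]
    by (simp add: add.commute[of _ c])
  have "emeasure (distr (leb n) (leb n) (translate n c)) (Pi\<^sub>E {1..n} A)
      = emeasure (leb n) (translate n c -` (Pi\<^sub>E {1..n} A) \<inter> space (leb n))"
    using A by (intro emeasure_distr sets_PiM_I_finite) auto
  also have "translate n c -` (Pi\<^sub>E {1..n} A) \<inter> space (leb n) = (\<Pi>\<^sub>E i\<in>{1..n}. (\<lambda>x. x + c) -` A i)"
    by (auto simp: translate_def space_PiM PiE_def Pi_def)
  also have "emeasure (leb n) \<dots> = (\<Prod>i\<in>{1..n}. emeasure lborel ((\<lambda>x. x + c) -` A i))"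
    using A by (intro lborel_product.emeasure_PiM) (auto intro!: measurable_sets_borel[of _ borel])
  also have "\<dots> = (\<Prod>i\<in>{1..n}. emeasure lborel (A i))"
    by (intro prod.cong pre) auto
  finally show "emeasure (distr (leb n) (leb n) (translate n c)) (Pi\<^sub>E {1..n} A)
      = (\<Prod>i\<in>{1..n}. emeasure lborel (A i))" .
qed auto

lemma nn_integral_leb_translate:
  assumes "h \<in> borel_measurable (leb n)"
  shows "(\<integral>\<^sup>+x. h (translate n c x) \<partial>leb n) = (\<integral>\<^sup>+x. h x \<partial>leb n)"
proof -
  have "(\<integral>\<^sup>+x. h x \<partial>leb n) = (\<integral>\<^sup>+x. h x \<partial>distr (leb n) (leb n) (translate n c))"
    by (simp only: distr_leb_translate)
  also have "\<dots> = (\<integral>\<^sup>+x. h (translate n c x) \<partial>leb n)"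
    using assms by (intro nn_integral_distr) auto
  finally show ?thesis ..
qed

text \<open>
  Insert a factor \<open>1 = \<integral>indicator {0..1} t dt\<close>, translate the sample by \<open>- t\<close>, reflect \<open>t\<close> in the
  sample mean, and translate back.
\<close>

lemma nn_integral_mean_factor:
  fixes \<phi> :: "real \<Rightarrow> ennreal" and \<psi> :: "(nat \<Rightarrow> real) \<Rightarrow> ennreal"
  assumes n: "n > 0"
    and \<phi> [measurable]: "\<phi> \<in> borel_measurable borel"
    and \<psi> [measurable]: "\<psi> \<in> borel_measurable (PiM {1..n} (\<lambda>_. borel))"
    and inv: "\<And>c x. \<psi> (translate n c x) = \<psi> x"
  shows "(\<integral>\<^sup>+x. \<phi> (sample_mean n x) * \<psi> x \<partial>leb n)
    = (\<integral>\<^sup>+t. \<phi> t \<partial>lborel) * (\<integral>\<^sup>+x. indicator {0..1} (sample_mean n x) * \<psi> x \<partial>leb n)"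
proof -
  interpret fin: finite_product_sigma_finite "\<lambda>_::nat. lborel :: real measure" "{1..n}"
    by standard auto
  interpret pair_sigma_finite lborel "leb n"
    by standard
  have sm [measurable]: "sample_mean n \<in> borel_measurable (leb n)"
    and [measurable]: "\<psi> \<in> borel_measurable (leb n)"
    using sample_mean_measurable[of n] \<psi> by (simp_all cong: measurable_cong_sets sets_PiM_cong)
  let ?J = "indicator {0..1} :: real \<Rightarrow> ennreal"
  let ?L = "\<integral>\<^sup>+x. \<phi> (sample_mean n x) * \<psi> x \<partial>leb n"
  have "?L = (\<integral>\<^sup>+t. ?J t * ?L \<partial>lborel)"
    by (subst nn_integral_multc) auto
  also have "\<dots> = (\<integral>\<^sup>+t. (\<integral>\<^sup>+x. ?J t * \<phi> (sample_mean n x - t) * \<psi> x \<partial>leb n) \<partial>lborel)"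
  proof (rule nn_integral_cong)
    fix t :: real
    have "?L = (\<integral>\<^sup>+x. \<phi> (sample_mean n x - t) * \<psi> x \<partial>leb n)"
      using nn_integral_leb_translate[of "\<lambda>x. \<phi> (sample_mean n x) * \<psi> x" n "- t"] n
      by (simp add: sample_mean_translate inv)
    then show "?J t * ?L = (\<integral>\<^sup>+x. ?J t * \<phi> (sample_mean n x - t) * \<psi> x \<partial>leb n)"
      by (simp add: mult.assoc nn_integral_cmult)
  qed
  also have "\<dots> = (\<integral>\<^sup>+x. (\<integral>\<^sup>+t. ?J t * \<phi> (sample_mean n x - t) * \<psi> x \<partial>lborel) \<partial>leb n)"
    by (rule Fubini'[symmetric]) measurable
  also have "\<dots> = (\<integral>\<^sup>+x. (\<integral>\<^sup>+t. ?J (sample_mean n x - t) * \<phi> t * \<psi> x \<partial>lborel) \<partial>leb n)"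
  proof (rule nn_integral_cong)
    fix x
    show "(\<integral>\<^sup>+t. ?J t * \<phi> (sample_mean n x - t) * \<psi> x \<partial>lborel)
        = (\<integral>\<^sup>+t. ?J (sample_mean n x - t) * \<phi> t * \<psi> x \<partial>lborel)"
      by (subst nn_integral_real_affine[where c="-1" and t="sample_mean n x"]) auto
  qed
  also have "\<dots> = (\<integral>\<^sup>+t. (\<integral>\<^sup>+x. ?J (sample_mean n x - t) * \<phi> t * \<psi> x \<partial>leb n) \<partial>lborel)"
    by (rule Fubini') measurable
  also have "\<dots> = (\<integral>\<^sup>+t. \<phi> t * (\<integral>\<^sup>+x. ?J (sample_mean n x) * \<psi> x \<partial>leb n) \<partial>lborel)"
  proof (rule nn_integral_cong)
    fix t :: real
    have "(\<integral>\<^sup>+x. ?J (sample_mean n x) * \<psi> x \<partial>leb n) = (\<integral>\<^sup>+x. ?J (sample_mean n x - t) * \<psi> x \<partial>leb n)"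
      using nn_integral_leb_translate[of "\<lambda>x. ?J (sample_mean n x) * \<psi> x" n "- t"] n
      by (simp add: sample_mean_translate inv)
    then show "(\<integral>\<^sup>+x. ?J (sample_mean n x - t) * \<phi> t * \<psi> x \<partial>leb n)
        = \<phi> t * (\<integral>\<^sup>+x. ?J (sample_mean n x) * \<psi> x \<partial>leb n)"
      by (simp add: nn_integral_cmult mult.left_commute mult.assoc)
  qed
  also have "\<dots> = (\<integral>\<^sup>+t. \<phi> t \<partial>lborel) * (\<integral>\<^sup>+x. ?J (sample_mean n x) * \<psi> x \<partial>leb n)"
    by (rule nn_integral_multc) simp
  finally show ?thesis .
qed

section \<open>The law of the sample, and independence as an identity on rectangles\<close>

lemma emeasure_iid_sample:
  assumes [measurable]: "f \<in> borel_measurable borel" and T [measurable]: "Measurable.pred (PiM {1..n} (\<lambda>_. borel)) T"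
  shows "emeasure (iid_sample n f) {x \<in> space (leb n). T x}
    = (\<integral>\<^sup>+x. ennreal (\<Prod>i = 1..n. f (x i)) * indicator (Collect T) x \<partial>leb n)"
proof -
  have [measurable]: "Measurable.pred (leb n) T"
    using T by (simp cong: measurable_cong_sets sets_PiM_cong)
  show ?thesis
    unfolding iid_sample_def
    by (subst emeasure_density) (auto intro!: nn_integral_cong simp: indicator_def)
qed

lemma iid_sample_box:
  assumes [measurable]: "f \<in> borel_measurable borel" and pos: "\<And>x. f x > 0"
    and A: "\<And>i. i \<in> {1..n} \<Longrightarrow> A i \<in> sets borel"
  shows "emeasure (iid_sample n f) (Pi\<^sub>E {1..n} A)
    = (\<Prod>i = 1..n. emeasure (density lborel (\<lambda>x. ennreal (f x))) (A i))"
proof -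
  have "emeasure (iid_sample n f) (Pi\<^sub>E {1..n} A)
      = (\<integral>\<^sup>+x. (\<Prod>i = 1..n. ennreal (f (x i)) * indicator (A i) (x i)) \<partial>leb n)"
    unfolding iid_sample_def using A
    by (subst emeasure_density)
       (auto intro!: nn_integral_cong sets_PiM_I_finite
         simp: prod.distrib prod_ennreal less_imp_le[OF pos] space_PiM PiE_iff extensional_def
           indicator_def split: if_splits)
  also have "\<dots> = (\<Prod>i = 1..n. (\<integral>\<^sup>+t. ennreal (f t) * indicator (A i) t \<partial>lborel))"
    using A by (intro lborel_product.product_nn_integral_prod) auto
  finally show ?thesis
    using A by (simp add: emeasure_density)
qed

lemma PiM_density_eq_iid_sample:
  assumes [measurable]: "f \<in> borel_measurable borel" and pos: "\<And>x. f x > 0"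
    and prob: "prob_space (density lborel (\<lambda>x. ennreal (f x)))"
  shows "PiM {1..n} (\<lambda>_. density lborel (\<lambda>x. ennreal (f x))) = iid_sample n f"
proof -
  interpret prob_space "density lborel (\<lambda>x. ennreal (f x))"
    by (rule prob)
  interpret product_sigma_finite "\<lambda>_::nat. density lborel (\<lambda>x. ennreal (f x))"
    by standard
  show ?thesis
    using iid_sample_box[OF assms(1) pos]
    by (intro PiM_eqI[symmetric]) (auto simp: sets_iid_sample cong: sets_PiM_cong)
qed

text \<open>Independence is a property of the joint law, and that law is the same whether computed
  on \<open>M\<close> or under the image measure of \<open>V\<close>.\<close>

lemma (in prob_space) indep_var_distr_comp:
  assumes V [measurable]: "V \<in> M \<rightarrow>\<^sub>M K"
    and X [measurable]: "X \<in> K \<rightarrow>\<^sub>M S" and Y [measurable]: "Y \<in> K \<rightarrow>\<^sub>M T"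
  shows "indep_var S (\<lambda>\<omega>. X (V \<omega>)) T (\<lambda>\<omega>. Y (V \<omega>))
    \<longleftrightarrow> prob_space.indep_var (distr M K V) S X T Y"
proof -
  interpret D: prob_space "distr M K V"
    by (rule prob_space_distr) simp
  show ?thesis
    unfolding indep_var_distribution_eq D.indep_var_distribution_eq
    by (simp add: distr_distr comp_def)
qed

lemma (in prob_space) indep_var_iff_emeasure:
  assumes [measurable]: "X \<in> M \<rightarrow>\<^sub>M S" "Y \<in> M \<rightarrow>\<^sub>M T"
  shows "indep_var S X T Y \<longleftrightarrow> (\<forall>A \<in> sets S. \<forall>B \<in> sets T.
    emeasure M {x \<in> space M. X x \<in> A \<and> Y x \<in> B}
      = emeasure M {x \<in> space M. X x \<in> A} * emeasure M {x \<in> space M. Y x \<in> B})"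
  (is "_ \<longleftrightarrow> ?R")
proof -
  interpret DX: prob_space "distr M S X"
    by (rule prob_space_distr) simp
  interpret DY: prob_space "distr M T Y"
    by (rule prob_space_distr) simp
  have joint: "emeasure (distr M (S \<Otimes>\<^sub>M T) (\<lambda>x. (X x, Y x))) (A \<times> B)
      = emeasure M {x \<in> space M. X x \<in> A \<and> Y x \<in> B}"
    if "A \<in> sets S" "B \<in> sets T" for A B
    using that by (subst emeasure_distr) (auto intro!: arg_cong[where f="emeasure M"])
  have marg: "emeasure (distr M S X) A = emeasure M {x \<in> space M. X x \<in> A}"
    "emeasure (distr M T Y) B = emeasure M {x \<in> space M. Y x \<in> B}"
    if "A \<in> sets S" "B \<in> sets T" for A B
    using that by (subst emeasure_distr; auto intro!: arg_cong[where f="emeasure M"])+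
  have "distr M S X \<Otimes>\<^sub>M distr M T Y = distr M (S \<Otimes>\<^sub>M T) (\<lambda>x. (X x, Y x)) \<longleftrightarrow> ?R"
  proof
    assume eq: "distr M S X \<Otimes>\<^sub>M distr M T Y = distr M (S \<Otimes>\<^sub>M T) (\<lambda>x. (X x, Y x))"
    show ?R
      using DY.emeasure_pair_measure_Times[of _ "distr M S X"] joint marg
      by (auto simp: eq)
  next
    assume ?R
    then show "distr M S X \<Otimes>\<^sub>M distr M T Y = distr M (S \<Otimes>\<^sub>M T) (\<lambda>x. (X x, Y x))"
      by (intro pair_measure_eqI DX.sigma_finite_measure_axioms DY.sigma_finite_measure_axioms)
        (auto simp: joint marg)
  qed
  then show ?thesis
    unfolding indep_var_distribution_eq by simp
qed

section \<open>Independence for factoring densities\<close>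

text \<open>The parallel axis identity: the difference of the two squares is linear in
  \<open>x i\<close>, so its sum depends on the sample through the mean.\<close>

lemma sum_sq_minus_eq:
  assumes "n > 0"
  shows "(\<Sum>i = 1..n. (x i - c)\<^sup>2) = sq_dev n x + real n * (sample_mean n x - c)\<^sup>2"
proof -
  have sum: "(\<Sum>i = 1..n. x i) = real n * sample_mean n x"
    using assms by (simp add: sample_mean_def)
  have "(\<Sum>i = 1..n. (x i - c)\<^sup>2) =
      (\<Sum>i = 1..n. (x i - sample_mean n x)\<^sup>2 + (2 * (sample_mean n x - c) * x i
        - (sample_mean n x - c) * (sample_mean n x + c)))"
    by (intro sum.cong) (auto simp: power2_eq_square algebra_simps)
  also have "\<dots> = sq_dev n x + (2 * (sample_mean n x - c) * (real n * sample_mean n x)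
        - real n * ((sample_mean n x - c) * (sample_mean n x + c)))"
    unfolding sum[symmetric] by (simp add: sum.distrib sum_subtractf sum_distrib_left sq_dev_def)
  also have "\<dots> = sq_dev n x + real n * (sample_mean n x - c)\<^sup>2"
    by (simp add: power2_eq_square algebra_simps)
  finally show ?thesis .
qed

lemma sq_dev_nonneg: "sq_dev n x \<ge> 0"
  by (simp add: sq_dev_def sum_nonneg)

lemma indep_mean_if_density_factors:
  assumes n: "n > 0" and prob: "prob_space (iid_sample n f)"
    and f [measurable]: "f \<in> borel_measurable borel"
    and \<phi> [measurable]: "\<phi> \<in> borel_measurable borel"
    and \<psi> [measurable]: "\<psi> \<in> borel_measurable (PiM {1..n} (\<lambda>_. borel))"
    and factor: "\<And>x. ennreal (\<Prod>i = 1..n. f (x i)) = \<phi> (sample_mean n x) * \<psi> x"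
    and \<psi>_inv: "\<And>c x. \<psi> (translate n c x) = \<psi> x"
    and Z [measurable]: "Z \<in> borel_measurable (PiM {1..n} (\<lambda>_. borel))"
    and Z_inv: "\<And>c x. Z (translate n c x) = Z x"
  shows "prob_space.indep_var (iid_sample n f) borel (sample_mean n) borel Z"
proof -
  interpret prob_space "iid_sample n f"
    by (rule prob)
  define a where "a A = (\<integral>\<^sup>+t. \<phi> t * indicator A t \<partial>lborel)" for A
  define k where "k B = (\<integral>\<^sup>+x. indicator {0..1} (sample_mean n x) * (\<psi> x * indicator B (Z x)) \<partial>leb n)" for B
  have joint: "emeasure (iid_sample n f) {x \<in> space (iid_sample n f). sample_mean n x \<in> A \<and> Z x \<in> B}
      = a A * k B" if [measurable]: "A \<in> sets borel" "B \<in> sets borel" for A B :: "real set"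
  proof -
    have "emeasure (iid_sample n f) {x \<in> space (iid_sample n f). sample_mean n x \<in> A \<and> Z x \<in> B}
        = emeasure (iid_sample n f) {x \<in> space (leb n). sample_mean n x \<in> A \<and> Z x \<in> B}"
      by (simp add: iid_sample_def)
    also have "\<dots> = (\<integral>\<^sup>+x. ennreal (\<Prod>i = 1..n. f (x i)) *
        indicator (Collect (\<lambda>x. sample_mean n x \<in> A \<and> Z x \<in> B)) x \<partial>leb n)"
      by (rule emeasure_iid_sample) measurable
    also have "\<dots> = (\<integral>\<^sup>+x. (\<phi> (sample_mean n x) * indicator A (sample_mean n x)) *
        (\<psi> x * indicator B (Z x)) \<partial>leb n)"
      by (intro nn_integral_cong) (auto simp: factor indicator_def)
    also have "\<dots> = a A * k B"
      unfolding a_def k_def by (rule nn_integral_mean_factor[OF n]) (auto simp: \<psi>_inv Z_inv)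
    finally show ?thesis .
  qed
  \<comment> \<open>The factors \<open>a\<close> and \<open>k\<close> need not be probabilities
    separately; total mass one normalizes their product, so the marginals multiply to the joint
    value.\<close>
  have "emeasure (iid_sample n f) (space (iid_sample n f)) = a UNIV * k UNIV"
    using joint[of UNIV UNIV] by simp
  then have one: "a UNIV * k UNIV = 1"
    by (simp add: emeasure_space_1)
  show ?thesis
  proof (subst indep_var_iff_emeasure, goal_cases)
    case 3
    show ?case
    proof (intro ballI)
      fix A B :: "real set"
      assume AB: "A \<in> sets borel" "B \<in> sets borel"
      have "a A * k UNIV * (a UNIV * k B) = a A * k B * (a UNIV * k UNIV)"
        by (simp only: ac_simps)
      then show "emeasure (iid_sample n f) {x \<in> space (iid_sample n f). sample_mean n x \<in> A \<and> Z x \<in> B}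
          = emeasure (iid_sample n f) {x \<in> space (iid_sample n f). sample_mean n x \<in> A}
          * emeasure (iid_sample n f) {x \<in> space (iid_sample n f). Z x \<in> B}"
        using joint[OF AB] joint[OF AB(1), of UNIV] joint[OF _ AB(2), of UNIV] one by simp
    qed
  qed measurable
qed

lemma indep_mean_if_normal:
  assumes n: "n > 0" and \<sigma>: "\<sigma> > 0" and prob: "prob_space (iid_sample n (normal_density \<mu> \<sigma>))"
    and Z: "Z \<in> borel_measurable (PiM {1..n} (\<lambda>_. borel))"
    and Z_inv: "\<And>c x. Z (translate n c x) = Z x"
  shows "prob_space.indep_var (iid_sample n (normal_density \<mu> \<sigma>)) borel (sample_mean n) borel Z"
proof -
  \<comment> \<open>The parallel axis identity splits the exponent into a term in the mean and a
    term in \<open>sq_dev\<close>, which is translation invariant.\<close>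
  define \<phi> where "\<phi> t = exp (- (real n * (t - \<mu>)\<^sup>2) / (2 * \<sigma>\<^sup>2))" for t
  define \<psi> where "\<psi> x = (1 / sqrt (2 * pi * \<sigma>\<^sup>2)) ^ n * exp (- sq_dev n x / (2 * \<sigma>\<^sup>2))" for x
  have "(\<Prod>i = 1..n. normal_density \<mu> \<sigma> (x i)) = \<phi> (sample_mean n x) * \<psi> x" for x
  proof -
    have "(\<Prod>i = 1..n. normal_density \<mu> \<sigma> (x i))
        = (1 / sqrt (2 * pi * \<sigma>\<^sup>2)) ^ n * exp (- (\<Sum>i = 1..n. (x i - \<mu>)\<^sup>2) / (2 * \<sigma>\<^sup>2))"
      by (simp add: normal_density_def prod.distrib prod_dividef power_divide
        sum_negf exp_sum[symmetric] sum_divide_distrib)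
    also have "\<dots> = \<phi> (sample_mean n x) * \<psi> x"
      unfolding sum_sq_minus_eq[OF n] \<phi>_def \<psi>_def
      by (simp add: exp_add[symmetric] add_divide_distrib diff_divide_distrib)
    finally show ?thesis .
  qed
  moreover have "\<phi> t \<ge> 0" "\<psi> x \<ge> 0" for t x
    by (auto simp: \<phi>_def \<psi>_def)
  ultimately show ?thesis
    using Z Z_inv
    by (intro indep_mean_if_density_factors[where \<phi>="\<lambda>t. ennreal (\<phi> t)" and \<psi>="\<lambda>x. ennreal (\<psi> x)"] n prob)
      (auto simp: ennreal_mult sq_dev_translate n \<psi>_def \<phi>_def[abs_def])
qed

section \<open>Local consequences of independence\<close>

lemma emeasure_density_Ioo_pos:
  assumes [measurable]: "f \<in> borel_measurable borel" and pos: "\<And>x. f x > 0" and "a < (b::real)"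
  shows "emeasure (density lborel (\<lambda>x. ennreal (f x))) {a<..<b} > 0"
proof (rule ccontr)
  assume "\<not> ?thesis"
  then have "{a<..<b} \<in> null_sets (density lborel (\<lambda>x. ennreal (f x)))"
    by (auto simp: null_sets_def)
  then have "AE x in lborel. x \<in> {a<..<b} \<longrightarrow> ennreal (f x) = 0"
    by (subst (asm) null_sets_density_iff) auto
  then have "AE x in lborel. x \<notin> {a<..<b}"
    by eventually_elim (metis pos ennreal_eq_0_iff not_le)
  then have "emeasure lborel {a<..<b} = 0"
    by (subst (asm) AE_iff_measurable[where N="{a<..<b}"]) auto
  then show False
    using \<open>a < b\<close> by simp
qed

text \<open>A positive density charges every open box; events are shown to have positive probability
  by exhibiting such a box inside them.\<close>

lemma iid_sample_box_pos:
  assumes f: "f \<in> borel_measurable borel" and pos: "\<And>x. f x > 0"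
    and ab: "\<And>i. i \<in> {1..n} \<Longrightarrow> a i < b i"
    and sub: "(\<Pi>\<^sub>E i\<in>{1..n}. {a i<..<b i}) \<subseteq> E" and E: "E \<in> sets (iid_sample n f)"
  shows "emeasure (iid_sample n f) E > 0"
proof -
  have "0 < (\<Prod>i = 1..n. emeasure (density lborel (\<lambda>x. ennreal (f x))) {a i<..<b i})"
    using emeasure_density_Ioo_pos[OF f pos] ab
    by (auto simp: zero_less_iff_neq_zero)
  also have "\<dots> = emeasure (iid_sample n f) (\<Pi>\<^sub>E i\<in>{1..n}. {a i<..<b i})"
    by (rule iid_sample_box[OF f pos, symmetric]) auto
  also have "\<dots> \<le> emeasure (iid_sample n f) E"
    by (rule emeasure_mono[OF sub E])
  finally show ?thesis .
qed

text \<open>The setting of the converse, free of \<open>U\<close>: \<open>Z\<close> enters through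
  translation invariance and comparability with a power of \<open>sq_dev\<close>.\<close>

locale indep_shift_statistic =
  fixes n :: nat and f :: "real \<Rightarrow> real" and Z :: "(nat \<Rightarrow> real) \<Rightarrow> real" and c C q :: real
  assumes n: "n \<ge> 2"
    and f_pos: "\<And>x. f x > 0"
    and f_cont: "continuous_on UNIV f"
    and prob: "prob_space (iid_sample n f)"
    and Z_meas [measurable]: "Z \<in> borel_measurable (PiM {1..n} (\<lambda>_. borel))"
    and Z_translate: "\<And>a x. Z (translate n a x) = Z x"
    and consts_pos: "c > 0" "C > 0" "q > 0"
    and Z_lower: "\<And>x. c * sq_dev n x powr q \<le> Z x"
    and Z_upper: "\<And>x. Z x \<le> C * sq_dev n x powr q"
    and indep: "prob_space.indep_var (iid_sample n f) borel (sample_mean n) borel Z"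
begin

sublocale prob_space "iid_sample n f"
  by (rule prob)

lemma f_meas [measurable]: "f \<in> borel_measurable borel"
  by (rule borel_measurable_continuous_onI[OF f_cont])

definition mean_window :: "real \<Rightarrow> real \<Rightarrow> (nat \<Rightarrow> real) set" where
  "mean_window \<delta> m = {x \<in> extensional {1..n}. sample_mean n x \<in> {m<..<m + \<delta>}}"

lemma prob_mean_window_pos:
  assumes "\<delta> > 0"
  shows "prob (mean_window \<delta> m) > 0"
proof -
  have "emeasure (iid_sample n f) (mean_window \<delta> m) > 0"
  proof (rule iid_sample_box_pos[OF f_meas f_pos, of n "\<lambda>_. m" "\<lambda>_. m + \<delta>"])
    show "(\<Pi>\<^sub>E i\<in>{1..n}. {m<..<m + \<delta>}) \<subseteq> mean_window \<delta> m"
    proof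
      fix x
      assume x: "x \<in> (\<Pi>\<^sub>E i\<in>{1..n}. {m<..<m + \<delta>})"
      then have "m < x i" "x i < m + \<delta>" if "i \<in> {1..n}" for i
        using that by (auto simp: PiE_iff)
      then have "(\<Sum>i = 1..n. m) < (\<Sum>i = 1..n. x i)" "(\<Sum>i = 1..n. x i) < (\<Sum>i = 1..n. m + \<delta>)"
        using n by (intro sum_strict_mono; force)+
      then show "x \<in> mean_window \<delta> m"
        using x n by (auto simp: mean_window_def sample_mean_def field_simps PiE_iff)
    qed
    have "{x \<in> space (iid_sample n f). sample_mean n x \<in> {m<..<m + \<delta>}} \<in> sets (iid_sample n f)"
      by measurable
    then show "mean_window \<delta> m \<in> sets (iid_sample n f)"
      by (simp add: mean_window_def space_iid_sample)
  qed (use assms in auto)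
  then show ?thesis
    by (simp add: emeasure_eq_measure)
qed

text \<open>Translating by \<open>m\<close> moves the window to \<open>{0<..<\<delta>}\<close> and
  fixes \<open>Z\<close>. The domain of integration becomes independent of \<open>m\<close>, so
  windows at different points can be compared pointwise.\<close>

lemma emeasure_window_statistic:
  assumes [measurable]: "S \<in> sets borel"
  shows "emeasure (iid_sample n f) {x \<in> mean_window \<delta> m. Z x \<in> S}
    = (\<integral>\<^sup>+x. ennreal (\<Prod>i = 1..n. f (m + x i)) *
        indicator {x. sample_mean n x \<in> {0<..<\<delta>} \<and> Z x \<in> S} x \<partial>leb n)"
proof -
  let ?T = "\<lambda>x. sample_mean n x \<in> {m<..<m + \<delta>} \<and> Z x \<in> S"
  let ?h = "\<lambda>x. ennreal (\<Prod>i = 1..n. f (x i)) * indicator (Collect ?T) x"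
  have [measurable]: "sample_mean n \<in> borel_measurable (leb n)" "Z \<in> borel_measurable (leb n)"
    using sample_mean_measurable[of n] Z_meas by (simp_all cong: measurable_cong_sets sets_PiM_cong)
  have "emeasure (iid_sample n f) {x \<in> mean_window \<delta> m. Z x \<in> S}
      = emeasure (iid_sample n f) {x \<in> space (leb n). ?T x}"
    using space_iid_sample[of n f]
    by (auto simp: mean_window_def iid_sample_def intro!: arg_cong[where f="emeasure _"])
  also have "\<dots> = (\<integral>\<^sup>+x. ?h x \<partial>leb n)"
    by (rule emeasure_iid_sample) measurable
  also have "\<dots> = (\<integral>\<^sup>+x. ?h (translate n m x) \<partial>leb n)"
    by (rule nn_integral_leb_translate[symmetric]) measurable
  also have "\<dots> = (\<integral>\<^sup>+x. ennreal (\<Prod>i = 1..n. f (m + x i)) *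
        indicator {x. sample_mean n x \<in> {0<..<\<delta>} \<and> Z x \<in> S} x \<partial>leb n)"
  proof (rule nn_integral_cong)
    fix x
    have "(\<Prod>i = 1..n. f (translate n m x i)) = (\<Prod>i = 1..n. f (m + x i))"
      by (intro prod.cong) (auto simp: translate_def add.commute)
    moreover have "?T (translate n m x) \<longleftrightarrow> sample_mean n x \<in> {0<..<\<delta>} \<and> Z x \<in> S"
      using n by (auto simp: Z_translate sample_mean_translate)
    ultimately show "?h (translate n m x) = ennreal (\<Prod>i = 1..n. f (m + x i)) *
        indicator {x. sample_mean n x \<in> {0<..<\<delta>} \<and> Z x \<in> S} x"
      by (simp add: indicator_def)
  qed
  finally show ?thesis .
qed

lemma prob_window_statistic:
  assumes [measurable]: "S \<in> sets borel"
  shows "prob {x \<in> mean_window \<delta> m. Z x \<in> S}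
    = prob (mean_window \<delta> m) * prob {x \<in> space (iid_sample n f). Z x \<in> S}"
proof -
  have sp: "{x \<in> mean_window \<delta> m. Z x \<in> S}
      = {x \<in> space (iid_sample n f). sample_mean n x \<in> {m<..<m + \<delta>} \<and> Z x \<in> S}"
    "mean_window \<delta> m = {x \<in> space (iid_sample n f). sample_mean n x \<in> {m<..<m + \<delta>}}"
    by (auto simp: mean_window_def space_iid_sample)
  have "emeasure (iid_sample n f) {x \<in> space (iid_sample n f). sample_mean n x \<in> {m<..<m + \<delta>} \<and> Z x \<in> S}
      = emeasure (iid_sample n f) {x \<in> space (iid_sample n f). sample_mean n x \<in> {m<..<m + \<delta>}}
      * emeasure (iid_sample n f) {x \<in> space (iid_sample n f). Z x \<in> S}"
    by (rule indep_var_iff_emeasure[THEN iffD1, rule_format, OF _ _ indep]) auto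
  then show ?thesis
    unfolding sp emeasure_eq_measure by (simp flip: ennreal_mult)
qed

text \<open>Integrate the pointwise inequality over the common domain. By independence both sides
  carry the factor that \<open>Z\<close> lies in \<open>S\<close>, which is positive and cancels;
  hence every \<open>S\<close> bounds the same two window probabilities.\<close>

lemma prob_mean_window_compare:
  assumes S: "S \<in> sets borel" and S_pos: "prob {x \<in> space (iid_sample n f). Z x \<in> S} > 0"
    and ab: "a \<ge> 0" "b \<ge> 0"
    and le: "\<And>x. 0 < sample_mean n x \<Longrightarrow> sample_mean n x < \<delta> \<Longrightarrow> Z x \<in> S \<Longrightarrow>
      a * (\<Prod>i = 1..n. f (m0 + x i)) \<le> b * (\<Prod>i = 1..n. f (m1 + x i))"
  shows "a * prob (mean_window \<delta> m0) \<le> b * prob (mean_window \<delta> m1)"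
proof -
  note [measurable] = S
  have [measurable]: "sample_mean n \<in> borel_measurable (leb n)" "Z \<in> borel_measurable (leb n)"
    using sample_mean_measurable[of n] Z_meas by (simp_all cong: measurable_cong_sets sets_PiM_cong)
  have prod_nonneg: "0 \<le> (\<Prod>i = 1..n. f (m + x i))" for m x
    by (intro prod_nonneg less_imp_le[OF f_pos])
  have "ennreal a * emeasure (iid_sample n f) {x \<in> mean_window \<delta> m0. Z x \<in> S}
      = (\<integral>\<^sup>+x. ennreal a * (ennreal (\<Prod>i = 1..n. f (m0 + x i)) *
        indicator {x. sample_mean n x \<in> {0<..<\<delta>} \<and> Z x \<in> S} x) \<partial>leb n)"
    unfolding emeasure_window_statistic[OF S] by (rule nn_integral_cmult[symmetric]) measurable
  also have "\<dots> \<le> (\<integral>\<^sup>+x. ennreal b * (ennreal (\<Prod>i = 1..n. f (m1 + x i)) *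
        indicator {x. sample_mean n x \<in> {0<..<\<delta>} \<and> Z x \<in> S} x) \<partial>leb n)"
    using le ab prod_nonneg
    by (intro nn_integral_mono) (auto simp: indicator_def simp flip: ennreal_mult intro!: ennreal_leI)
  also have "\<dots> = ennreal b * emeasure (iid_sample n f) {x \<in> mean_window \<delta> m1. Z x \<in> S}"
    unfolding emeasure_window_statistic[OF S] by (rule nn_integral_cmult) measurable
  finally have "a * prob {x \<in> mean_window \<delta> m0. Z x \<in> S} \<le> b * prob {x \<in> mean_window \<delta> m1. Z x \<in> S}"
    using ab by (simp add: emeasure_eq_measure flip: ennreal_mult)
  then show ?thesis
    using S_pos unfolding prob_window_statistic[OF S] by (simp add: mult.assoc[symmetric])
qed

text \<open>The lower bound on \<open>Z\<close> turns an upper limit for \<open>Z\<close> into one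
  for \<open>sq_dev\<close>, and the upper bound does the same for lower limits. Positivity comes
  from a box of samples with \<open>sq_dev\<close> between \<open>\<eta>\<^sup>2 / 2\<close> and
  \<open>k * r\<close>.\<close>

lemma ex_shell:
  assumes "r > 0"
  obtains S w where "S \<in> sets borel" "prob {x \<in> space (iid_sample n f). Z x \<in> S} > 0" "w > 0"
    "\<And>x. Z x \<in> S \<Longrightarrow> w \<le> sq_dev n x" "\<And>x. Z x \<in> S \<Longrightarrow> sq_dev n x \<le> r"
proof -
  \<comment> \<open>Chosen so that \<open>C * k powr q = c\<close>, which exchanges the two
    comparison constants; \<open>\<eta>\<close> then makes \<open>n\<close> squares of
    \<open>3 * \<eta>\<close> add up to \<open>k * r\<close>.\<close>
  define k where "k = (c / C) powr (1 / q)"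
  define \<eta> where "\<eta> = sqrt (k * r / (9 * real n))"
  define S where "S = {c * (\<eta>\<^sup>2 / 2) powr q .. c * r powr q}"
  have k: "k > 0" "k powr q = c / C"
    using consts_pos by (auto simp: k_def powr_powr)
  have \<eta>: "\<eta> > 0" "9 * real n * \<eta>\<^sup>2 = k * r"
    using assms k n by (auto simp: \<eta>_def)
  show ?thesis
  proof (rule that[of S "k * (\<eta>\<^sup>2 / 2)"])
    show "S \<in> sets borel"
      by (simp add: S_def)
    show "k * (\<eta>\<^sup>2 / 2) > 0"
      using k \<eta> by simp
    show "sq_dev n x \<le> r" if "Z x \<in> S" for x
    proof (rule ccontr)
      assume "\<not> sq_dev n x \<le> r"
      then have "c * r powr q < c * sq_dev n x powr q"
        using consts_pos assms by (intro mult_strict_left_mono powr_less_mono2) auto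
      then show False
        using Z_lower[of x] that by (auto simp: S_def)
    qed
    show "k * (\<eta>\<^sup>2 / 2) \<le> sq_dev n x" if "Z x \<in> S" for x
    proof (rule ccontr)
      assume "\<not> k * (\<eta>\<^sup>2 / 2) \<le> sq_dev n x"
      then have "C * sq_dev n x powr q < C * (k * (\<eta>\<^sup>2 / 2)) powr q"
        using consts_pos by (intro mult_strict_left_mono powr_less_mono2 sq_dev_nonneg) auto
      also have "\<dots> = c * (\<eta>\<^sup>2 / 2) powr q"
        using k consts_pos by (subst powr_mult) auto
      finally show False
        using Z_upper[of x] that by (auto simp: S_def)
    qed
    \<comment> \<open>The first coordinate is kept at distance more than \<open>\<eta>\<close> from
      the others, while all stay between 0 and \<open>3 * \<eta>\<close>.\<close>
    define a where "a i = (if i = 1 then 0 else 2 * \<eta>)" for i :: nat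
    have "emeasure (iid_sample n f) {x \<in> space (iid_sample n f). Z x \<in> S} > 0"
    proof (rule iid_sample_box_pos[OF f_meas f_pos, of n a "\<lambda>i. a i + \<eta>"])
      show "(\<Pi>\<^sub>E i\<in>{1..n}. {a i<..<a i + \<eta>}) \<subseteq> {x \<in> space (iid_sample n f). Z x \<in> S}"
      proof
        fix x
        assume x: "x \<in> (\<Pi>\<^sub>E i\<in>{1..n}. {a i<..<a i + \<eta>})"
        have range: "0 < x i" "x i < 3 * \<eta>" if "i \<in> {1..n}" for i
        proof -
          have "a i < x i" "x i < a i + \<eta>"
            using x that by (auto simp: PiE_iff)
          then show "0 < x i" "x i < 3 * \<eta>"
            using \<eta>(1) by (auto simp: a_def split: if_splits)
        qed
        have "0 \<le> (\<Sum>i = 1..n. x i)" "(\<Sum>i = 1..n. x i) \<le> (\<Sum>i = 1..n. 3 * \<eta>)"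
          using range by (intro sum_nonneg sum_mono less_imp_le; blast)+
        then have mean: "0 \<le> sample_mean n x" "sample_mean n x \<le> 3 * \<eta>"
          using n by (auto simp: sample_mean_def field_simps)
        have "sq_dev n x \<le> (\<Sum>i = 1..n. (3 * \<eta>)\<^sup>2)"
          unfolding sq_dev_def
        proof (intro sum_mono)
          fix i assume "i \<in> {1..n}"
          then show "(x i - sample_mean n x)\<^sup>2 \<le> (3 * \<eta>)\<^sup>2"
            using range[of i] mean by (intro abs_le_square_iff[THEN iffD1]) auto
        qed
        then have upper: "sq_dev n x \<le> k * r"
          using \<eta>(2) by (simp add: power_mult_distrib)
        have "x 1 < \<eta>" "x 2 > 2 * \<eta>"
          using PiE_mem[OF x, of 1] PiE_mem[OF x, of 2] n by (auto simp: a_def)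
        then have "\<eta>\<^sup>2 \<le> (x 1 - x 2)\<^sup>2"
          using \<eta> by (intro abs_le_square_iff[THEN iffD1]) auto
        also have "\<dots> \<le> 2 * ((x 1 - sample_mean n x)\<^sup>2 + (x 2 - sample_mean n x)\<^sup>2)"
          using zero_le_power2[of "(x 1 - sample_mean n x) + (x 2 - sample_mean n x)"]
          by (simp add: power2_eq_square algebra_simps)
        also have "(x 1 - sample_mean n x)\<^sup>2 + (x 2 - sample_mean n x)\<^sup>2
            = (\<Sum>i\<in>{1, 2}. (x i - sample_mean n x)\<^sup>2)"
          by simp
        also have "\<dots> \<le> sq_dev n x"
          unfolding sq_dev_def using n by (intro sum_mono2) auto
        finally have lower: "\<eta>\<^sup>2 / 2 \<le> sq_dev n x"
          by simp
        have "Z x \<le> C * sq_dev n x powr q"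
          by (rule Z_upper)
        also have "\<dots> \<le> C * (k * r) powr q"
          using upper consts_pos by (intro mult_left_mono powr_mono2 sq_dev_nonneg) auto
        also have "\<dots> = c * r powr q"
          using k assms consts_pos by (subst powr_mult) auto
        finally have "Z x \<le> c * r powr q" .
        moreover have "c * (\<eta>\<^sup>2 / 2) powr q \<le> c * sq_dev n x powr q"
          using lower consts_pos by (intro mult_left_mono powr_mono2) auto
        then have "c * (\<eta>\<^sup>2 / 2) powr q \<le> Z x"
          using Z_lower[of x] by linarith
        ultimately show "x \<in> {x \<in> space (iid_sample n f). Z x \<in> S}"
          using x by (simp add: S_def space_iid_sample PiE_def)
      qed
    next
      show "{x \<in> space (iid_sample n f). Z x \<in> S} \<in> sets (iid_sample n f)"
        unfolding S_def by measurable
    qed (use \<eta> in auto)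
    then show "prob {x \<in> space (iid_sample n f). Z x \<in> S} > 0"
      by (simp add: emeasure_eq_measure)
  qed
qed

text \<open>Puts each coordinate near 0, so that local bounds on the log density apply to
  it.\<close>

lemma abs_le_if_sq_dev_le:
  assumes "sq_dev n x \<le> r\<^sup>2" "0 < sample_mean n x" "sample_mean n x < \<delta>" "r \<ge> 0" and i: "i \<in> {1..n}"
  shows "\<bar>x i\<bar> \<le> r + \<delta>"
proof -
  have "(x i - sample_mean n x)\<^sup>2 \<le> sq_dev n x"
    unfolding sq_dev_def using i by (intro member_le_sum) auto
  then have "\<bar>x i - sample_mean n x\<bar> \<le> r"
    using assms by (metis abs_le_square_iff abs_of_nonneg order_trans)
  then show ?thesis
    using assms by linarith
qed

text \<open>Two shells bound the same ratio of window probabilities: the curvature gap yields a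
  factor \<open>exp (- \<gamma>)\<close>, whereas a much thinner shell allows a loss of at most
  \<open>exp (- \<gamma> / 2)\<close>.\<close>

lemma log_density_touch_ordered:
  assumes above: "touch_above (\<lambda>t. ln (f t)) k" and below: "touch_above (\<lambda>t. - ln (f t)) (- k')"
  shows "k' \<le> k"
proof (rule ccontr)
  assume "\<not> k' \<le> k"
  then have kk: "k < k'"
    by simp
  define l where "l t = ln (f t)" for t
  have n0: "n > 0"
    using n by simp
  have prod_f: "(\<Prod>i = 1..n. f (m + x i)) = exp (\<Sum>i = 1..n. l (m + x i))" for m and x :: "nat \<Rightarrow> real"
    using f_pos by (simp add: exp_sum l_def)
  obtain m0 b0 h0 where h0: "h0 > 0"
    and up: "\<And>t. \<bar>t\<bar> \<le> h0 \<Longrightarrow> l (m0 + t) \<le> l m0 + b0 * t + k / 2 * t\<^sup>2"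
    using above unfolding touch_above_def l_def by blast
  obtain m1 b1 h1 where h1: "h1 > 0"
    and "\<And>t. \<bar>t\<bar> \<le> h1 \<Longrightarrow> - l (m1 + t) \<le> - l m1 + b1 * t + (- k') / 2 * t\<^sup>2"
    using below unfolding touch_above_def l_def by blast
  then have dn: "\<And>t. \<bar>t\<bar> \<le> h1 \<Longrightarrow> l m1 - b1 * t + k' / 2 * t\<^sup>2 \<le> l (m1 + t)"
    by force
  \<comment> \<open>Half the radius, because coordinates are bounded by \<open>h + \<delta>\<close>
    and \<open>\<delta> \<le> h\<close>.\<close>
  define h where "h = min h0 h1 / 2"
  have h: "h > 0"
    using h0 h1 by (simp add: h_def)
  obtain S w where S: "S \<in> sets borel" "prob {x \<in> space (iid_sample n f). Z x \<in> S} > 0"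
    and w: "w > 0" "\<And>x. Z x \<in> S \<Longrightarrow> w \<le> sq_dev n x"
    and Sh: "\<And>x. Z x \<in> S \<Longrightarrow> sq_dev n x \<le> h\<^sup>2"
    using ex_shell[of "h\<^sup>2"] h by auto
  \<comment> \<open>The quadratic terms differ by at least \<open>2 * \<gamma>\<close> on the shell:
    one \<open>\<gamma>\<close> pays for the linear terms, the other is the gain.\<close>
  define \<gamma> where "\<gamma> = (k' - k) * w / 4"
  have \<gamma>: "\<gamma> > 0"
    using kk w by (simp add: \<gamma>_def)
  have l_cont: "isCont l m" for m
    using f_cont f_pos unfolding l_def[abs_def]
    by (intro continuous_intros) (auto simp: continuous_on_eq_continuous_at less_imp_neq[symmetric])
  \<comment> \<open>Summed over \<open>n\<close> coordinates at two base points, this oscillation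
    costs \<open>\<gamma> / 2\<close> in total.\<close>
  have "\<exists>d>0. \<forall>t. \<bar>t\<bar> \<le> d \<longrightarrow> \<bar>l (m + t) - l m\<bar> \<le> \<gamma> / (4 * n)" for m
  proof -
    obtain d where d: "d > 0" "\<And>y. dist y m < d \<Longrightarrow> dist (l y) (l m) < \<gamma> / (4 * n)"
      using l_cont[of m] \<gamma> n0 unfolding continuous_at_eps_delta
      by (metis divide_pos_pos mult_pos_pos of_nat_0_less_iff zero_less_numeral)
    have "\<bar>l (m + t) - l m\<bar> \<le> \<gamma> / (4 * n)" if "\<bar>t\<bar> \<le> d / 2" for t
      using d(2)[of "m + t"] d(1) that by (simp add: dist_real_def)
    then show ?thesis
      using d(1) by (intro exI[of _ "d / 2"]) auto
  qed
  then obtain d0 d1 where d: "d0 > 0" "d1 > 0"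
    and osc: "\<And>t. \<bar>t\<bar> \<le> d0 \<Longrightarrow> \<bar>l (m0 + t) - l m0\<bar> \<le> \<gamma> / (4 * n)"
      "\<And>t. \<bar>t\<bar> \<le> d1 \<Longrightarrow> \<bar>l (m1 + t) - l m1\<bar> \<le> \<gamma> / (4 * n)"
    by meson
  define e where "e = min d0 d1 / 2"
  have e: "e > 0"
    using d by (simp add: e_def)
  \<comment> \<open>The last bound keeps the linear terms below \<open>\<gamma>\<close>, as they
    depend on the mean alone; adding 1 avoids a zero denominator.\<close>
  define \<delta> where "\<delta> = min (min h e) (\<gamma> / (n * (\<bar>b0 + b1\<bar> + 1)))"
  have \<delta>: "\<delta> > 0" "\<delta> \<le> h" "\<delta> \<le> e"
    using h e \<gamma> n0 by (auto simp: \<delta>_def)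
  have "\<delta> \<le> \<gamma> / (n * (\<bar>b0 + b1\<bar> + 1))"
    by (simp add: \<delta>_def)
  then have \<delta>': "\<delta> * (n * (\<bar>b0 + b1\<bar> + 1)) \<le> \<gamma>"
    using n0 by (simp add: pos_le_divide_eq add_nonneg_pos)

  \<comment> \<open>The curvature gap gains a factor \<open>exp (- \<gamma>)\<close> on the shell \<open>S\<close>, as \<open>W \<ge> w\<close> there.\<close>
  have upper: "exp (n * l m1 + \<gamma>) * prob (mean_window \<delta> m0) \<le> exp (n * l m0) * prob (mean_window \<delta> m1)"
  proof (rule prob_mean_window_compare[OF S])
    fix x
    assume x: "0 < sample_mean n x" "sample_mean n x < \<delta>" "Z x \<in> S"
    have small: "\<bar>x i\<bar> \<le> h0" "\<bar>x i\<bar> \<le> h1" if "i \<in> {1..n}" for i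
      using abs_le_if_sq_dev_le[OF Sh[OF x(3)] x(1,2) _ that] h \<delta> by (auto simp: h_def)
    have sum: "(\<Sum>i = 1..n. x i) = n * sample_mean n x"
      using n0 by (simp add: sample_mean_def)
    define Q where "Q = (\<Sum>i = 1..n. (x i)\<^sup>2)"
    have "Q = sq_dev n x + n * (sample_mean n x)\<^sup>2"
      using sum_sq_minus_eq[OF n0, of x 0] by (simp add: Q_def)
    then have Q: "w \<le> Q"
      using w(2)[OF x(3)] by (smt (verit) of_nat_0_le_iff zero_le_power2 mult_nonneg_nonneg)
    have "(\<Sum>i = 1..n. l (m0 + x i)) \<le> (\<Sum>i = 1..n. l m0 + b0 * x i + k / 2 * (x i)\<^sup>2)"
      using small by (intro sum_mono up) auto
    also have "\<dots> = n * l m0 + b0 * (n * sample_mean n x) + k / 2 * Q"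
      unfolding sum[symmetric] Q_def by (simp add: sum.distrib sum_distrib_left)
    finally have 1: "(\<Sum>i = 1..n. l (m0 + x i)) \<le> n * l m0 + b0 * (n * sample_mean n x) + k / 2 * Q" .
    have "n * l m1 - b1 * (n * sample_mean n x) + k' / 2 * Q
        = (\<Sum>i = 1..n. l m1 - b1 * x i + k' / 2 * (x i)\<^sup>2)"
      unfolding sum[symmetric] Q_def by (simp add: sum.distrib sum_subtractf sum_distrib_left)
    also have "\<dots> \<le> (\<Sum>i = 1..n. l (m1 + x i))"
      using small by (intro sum_mono dn) auto
    finally have 2: "n * l m1 - b1 * (n * sample_mean n x) + k' / 2 * Q \<le> (\<Sum>i = 1..n. l (m1 + x i))" .
    have "(b0 + b1) * (n * sample_mean n x) \<le> (\<bar>b0 + b1\<bar> + 1) * (n * \<delta>)"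
      using x n0 by (intro mult_mono) auto
    then have 3: "(b0 + b1) * (n * sample_mean n x) \<le> \<gamma>"
      using \<delta>' by (simp add: mult.commute mult.left_commute)
    have "(k' - k) * w \<le> (k' - k) * Q"
      using kk Q by (intro mult_left_mono) auto
    then have "2 * \<gamma> \<le> k' / 2 * Q - k / 2 * Q"
      by (simp add: \<gamma>_def field_simps)
    then have "n * l m1 + \<gamma> + (\<Sum>i = 1..n. l (m0 + x i)) \<le> n * l m0 + (\<Sum>i = 1..n. l (m1 + x i))"
      using 1 2 3 by (simp add: distrib_right)
    then show "exp (n * l m1 + \<gamma>) * (\<Prod>i = 1..n. f (m0 + x i)) \<le> exp (n * l m0) * (\<Prod>i = 1..n. f (m1 + x i))"
      unfolding prod_f exp_add[symmetric] by simp
  qed auto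

  \<comment> \<open>On a shell so thin that \<open>l\<close> is nearly constant, at most \<open>exp (\<gamma> / 2)\<close> is lost.\<close>
  obtain S' w' where S': "S' \<in> sets borel" "prob {x \<in> space (iid_sample n f). Z x \<in> S'} > 0"
    and "w' > 0" "\<And>x. Z x \<in> S' \<Longrightarrow> w' \<le> sq_dev n x"
    and S'h: "\<And>x. Z x \<in> S' \<Longrightarrow> sq_dev n x \<le> e\<^sup>2"
    using ex_shell[of "e\<^sup>2"] e by auto
  have "exp (n * l m0) * prob (mean_window \<delta> m1) \<le> exp (n * l m1 + \<gamma> / 2) * prob (mean_window \<delta> m0)"
  proof (rule prob_mean_window_compare[OF S'])
    fix x
    assume x: "0 < sample_mean n x" "sample_mean n x < \<delta>" "Z x \<in> S'"
    have small: "\<bar>x i\<bar> \<le> d0" "\<bar>x i\<bar> \<le> d1" if "i \<in> {1..n}" for i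
      using abs_le_if_sq_dev_le[OF S'h[OF x(3)] x(1,2) _ that] e \<delta> by (auto simp: e_def)
    have "(\<Sum>i = 1..n. l (m1 + x i) - l (m0 + x i)) \<le> (\<Sum>i = 1..n. l m1 - l m0 + \<gamma> / (2 * n))"
    proof (intro sum_mono)
      fix i assume i: "i \<in> {1..n}"
      have "\<gamma> / (2 * n) = \<gamma> / (4 * n) + \<gamma> / (4 * n)"
        by simp
      then show "l (m1 + x i) - l (m0 + x i) \<le> l m1 - l m0 + \<gamma> / (2 * n)"
        using osc(1)[OF small(1)[OF i]] osc(2)[OF small(2)[OF i]] by linarith
    qed
    also have "\<dots> = n * l m1 - n * l m0 + \<gamma> / 2"
      using n0 by (simp add: algebra_simps)
    finally show "exp (n * l m0) * (\<Prod>i = 1..n. f (m1 + x i)) \<le> exp (n * l m1 + \<gamma> / 2) * (\<Prod>i = 1..n. f (m0 + x i))"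
      unfolding prod_f exp_add[symmetric] by (simp add: sum_subtractf)
  qed auto
  with upper have "exp (n * l m1 + \<gamma>) * prob (mean_window \<delta> m0) \<le> exp (n * l m1 + \<gamma> / 2) * prob (mean_window \<delta> m0)"
    by linarith
  then show False
    using prob_mean_window_pos[OF \<delta>(1), of m0] \<gamma> by simp
qed

lemma is_normal:
  assumes "prob_space (density lborel (\<lambda>x. ennreal (f x)))"
  shows "is_normal_distribution (density lborel (\<lambda>x. ennreal (f x)))"
proof -
  have cont: "continuous_on UNIV (\<lambda>t. ln (f t))"
    using f_pos by (intro continuous_intros f_cont) (auto simp: less_imp_neq[symmetric])
  have "\<exists>a b k. \<forall>t. ln (f t) = a + b * t + k / 2 * t\<^sup>2"
    by (rule quadratic_if_touch_ordered[OF cont]) (rule log_density_touch_ordered)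
  then obtain a b k where "\<And>t. ln (f t) = a + b * t + k / 2 * t\<^sup>2"
    by blast
  then have "f t = exp (a + b * t + k / 2 * t\<^sup>2)" for t
    using f_pos[of t] by (metis exp_ln)
  then show ?thesis
    by (rule normal_if_log_quadratic[OF assms])
qed

end

section \<open>Order statistics and feasible definite functions\<close>

text \<open>In a sorted list the entries at most \<open>c\<close> form a prefix.\<close>

lemma sorted_nth_le_iff:
  assumes "sorted ys" "j < length ys"
  shows "ys ! j \<le> c \<longleftrightarrow> j < length (filter (\<lambda>y. y \<le> c) ys)"
  using assms
proof (induction ys arbitrary: j)
  case (Cons y ys)
  show ?case
  proof (cases "y \<le> c")
    case True
    then show ?thesis
      using Cons by (cases j) auto
  next
    case False
    then have "filter (\<lambda>y. y \<le> c) (y # ys) = []"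
      using Cons.prems by (auto simp: filter_empty_conv)
    moreover have "y \<le> (y # ys) ! j"
      using Cons.prems by (cases j) auto
    ultimately show ?thesis
      using False by auto
  qed
qed simp

lemma order_stat_le_iff:
  assumes "k \<in> {1..n}"
  shows "order_stat n x k \<le> c \<longleftrightarrow> k \<le> card {i \<in> {1..n}. x i \<le> c}"
proof -
  let ?ys = "sort (map x [1..<Suc n])"
  \<comment> \<open>Rank \<open>k\<close> is list position \<open>k - 1\<close>; since
    \<open>k \<ge> 1\<close>, the strict bound on the position becomes \<open>k \<le>\<close> the
    count.\<close>
  have "order_stat n x k \<le> c \<longleftrightarrow> k - 1 < length (filter (\<lambda>y. y \<le> c) ?ys)"
    unfolding order_stat_def using assms by (intro sorted_nth_le_iff) auto
  also have "length (filter (\<lambda>y. y \<le> c) ?ys) = length (filter (\<lambda>i. x i \<le> c) [1..<Suc n])"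
    by (simp only: filter_sort length_sort filter_map length_map comp_def)
  also have "\<dots> = card {i \<in> {1..n}. x i \<le> c}"
    by (subst distinct_length_filter) (auto intro!: arg_cong[where f=card])
  finally show ?thesis
    using assms by auto
qed

text \<open>The counting description replaces sorting by a finite sum of indicators.\<close>

lemma order_stat_measurable:
  assumes "k \<in> {1..n}"
  shows "(\<lambda>x. order_stat n x k) \<in> borel_measurable (PiM {1..n} (\<lambda>_. borel))"
proof (rule borel_measurableI_le)
  fix c
  have "{x \<in> space (PiM {1..n} (\<lambda>_. borel)). order_stat n x k \<le> c}
      = {x \<in> space (PiM {1..n} (\<lambda>_. borel)). real k \<le> (\<Sum>i = 1..n. if x i \<le> c then 1 else 0)}"
    unfolding order_stat_le_iff[OF assms] by (simp add: sum.If_cases Int_def)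
  also have "\<dots> \<in> sets (PiM {1..n} (\<lambda>_. borel))"
    by measurable
  finally show "{x \<in> space (PiM {1..n} (\<lambda>_. borel)). order_stat n x k \<le> c}
    \<in> sets (PiM {1..n} (\<lambda>_. borel :: real measure))" .
qed

lemma order_stat_mono:
  assumes "i \<in> {1..n}" "j \<in> {1..n}" "i \<le> j"
  shows "order_stat n x i \<le> order_stat n x j"
  unfolding order_stat_def using assms by (intro sorted_nth_mono) auto

lemma sum_order_stat: "(\<Sum>k = 1..n. g (order_stat n x k)) = (\<Sum>i = 1..n. g (x i) :: real)"
proof -
  let ?ys = "sort (map x [1..<Suc n])"
  have "(\<Sum>k = 1..n. g (order_stat n x k)) = (\<Sum>j<n. g (?ys ! j))"
    unfolding order_stat_def
    by (rule sum.reindex_bij_witness[of _ Suc "\<lambda>k. k - 1"]) auto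
  also have "\<dots> = sum_list (map g ?ys)"
    by (simp add: sum_list_sum_nth atLeast0LessThan)
  also have "\<dots> = sum_list (map g (map x [1..<Suc n]))"
    by (intro sum_mset_sum_list[symmetric, THEN trans] trans[OF _ sum_mset_sum_list])
      (simp only: mset_map mset_sort)
  also have "\<dots> = (\<Sum>i = 1..n. g (x i))"
    by (simp add: sum_list_distinct_conv_sum_set atLeastLessThanSuc_atLeastAtMost comp_def)
  finally show ?thesis .
qed

text \<open>Adding a constant preserves order, hence commutes with sorting.\<close>

lemma order_stat_translate:
  assumes "k \<in> {1..n}"
  shows "order_stat n (translate n a x) k = order_stat n x k + a"
proof -
  have "sort (map (translate n a x) [1..<Suc n]) = map (\<lambda>y. y + a) (sort (map x [1..<Suc n]))"
  proof (rule properties_for_sort)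
    show "mset (map (\<lambda>y. y + a) (sort (map x [1..<Suc n]))) = mset (map (translate n a x) [1..<Suc n])"
      by (auto simp: translate_def multiset.map_comp comp_def intro!: image_mset_cong)
    show "sorted (map (\<lambda>y. y + a) (sort (map x [1..<Suc n])))"
      by (simp add: sorted_map sorted_wrt_map sorted_sort)
  qed
  then show ?thesis
    using assms by (auto simp: order_stat_def)
qed

section \<open>Base statistics: measurability and comparison with powers of
  \<open>sq_dev\<close>\<close>

definition sorted_dev :: "nat \<Rightarrow> (nat \<Rightarrow> real) \<Rightarrow> nat \<Rightarrow> real" where
  "sorted_dev n x = (\<lambda>k\<in>{1..n}. order_stat n x k - sample_mean n x)"

lemma base_statistic_eq: "base_statistic n U x = U (sorted_dev n x)"
  by (simp add: base_statistic_def sorted_dev_def)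

lemma sorted_dev_in: "n > 0 \<Longrightarrow> sorted_dev n x \<in> ordered_zero_sum n"
  using sum_order_stat[of "\<lambda>t. t" n x] order_stat_mono[of _ n _ x]
  by (auto simp: ordered_zero_sum_def sorted_dev_def mono_on_def sum_subtractf sample_mean_def)

lemma sum_sorted_dev_sq: "(\<Sum>k = 1..n. (sorted_dev n x k)\<^sup>2) = sq_dev n x"
  using sum_order_stat[of "\<lambda>t. (t - sample_mean n x)\<^sup>2" n x] by (simp add: sorted_dev_def sq_dev_def)

lemma base_statistic_translate: "n > 0 \<Longrightarrow> base_statistic n U (translate n a x) = base_statistic n U x"
  unfolding base_statistic_def sample_mean_translate
  by (intro arg_cong[where f=U] restrict_ext) (simp add: order_stat_translate)

lemma sample_mean_restrict: "sample_mean n (restrict x {1..n}) = sample_mean n x"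
  by (simp add: sample_mean_def)

text \<open>Lets a family indexed by all naturals be replaced by a point of the product space, which
  is extensional.\<close>

lemma base_statistic_restrict: "base_statistic n U (restrict x {1..n}) = base_statistic n U x"
proof -
  have "map (restrict x {1..n}) [1..<Suc n] = map x [1..<Suc n]"
    by auto
  then show ?thesis
    by (simp only: base_statistic_def order_stat_def sample_mean_restrict)
qed

text \<open>Continuity of \<open>U\<close> is given on \<open>ordered_zero_sum n\<close>, so the
  deviations are first regarded as a map into that subspace.\<close>

lemma base_statistic_measurable:
  assumes "n > 0" and "feasible_definite n p U"
  shows "base_statistic n U \<in> borel_measurable (PiM {1..n} (\<lambda>_. borel))"
proof -
  have "sorted_dev n \<in> PiM {1..n} (\<lambda>_. borel) \<rightarrow>\<^sub>M borel"
  proof (rule measurable_coordinatewise_then_product)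
    fix k
    show "(\<lambda>x. sorted_dev n x k) \<in> borel_measurable (PiM {1..n} (\<lambda>_. borel))"
      using order_stat_measurable[of k n]
      by (cases "k \<in> {1..n}") (auto simp: sorted_dev_def)
  qed
  then have "sorted_dev n \<in> PiM {1..n} (\<lambda>_. borel) \<rightarrow>\<^sub>M restrict_space borel (ordered_zero_sum n)"
    using sorted_dev_in[OF assms(1)] by (intro measurable_restrict_space2) auto
  moreover have "U \<in> borel_measurable (restrict_space borel (ordered_zero_sum n))"
    using assms(2) by (intro borel_measurable_continuous_on_restrict) (simp add: feasible_definite_def)
  ultimately show ?thesis
    unfolding base_statistic_eq[abs_def] by (rule measurable_compose)
qed

text \<open>The set is cut out of a compact product by closed conditions on coordinates.\<close>

lemma compact_ordered_zero_sum_sphere: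
  "compact {v \<in> ordered_zero_sum n. (\<Sum>i = 1..n. (v i)\<^sup>2) = 1}" (is "compact ?K")
proof -
  \<comment> \<open>Coordinates outside \<open>{1..n}\<close> are pinned to the single point
    \<open>undefined\<close>, so every factor is compact and Tychonoff applies to the full
    product.\<close>
  let ?B = "PiE UNIV (\<lambda>i. if i \<in> {1..n} then {-1..1} else {undefined}) :: (nat \<Rightarrow> real) set"
  let ?O = "\<Inter>i\<in>{1..n}. \<Inter>j\<in>{i..n}. {v :: nat \<Rightarrow> real. v i \<le> v j}"
  let ?S = "{v :: nat \<Rightarrow> real. (\<Sum>i = 1..n. v i) = 0} \<inter> {v. (\<Sum>i = 1..n. (v i)\<^sup>2) = 1}"
  have "compactin (product_topology (\<lambda>_. euclidean) UNIV) ?B"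
    unfolding compactin_PiE by simp
  then have B: "compact ?B"
    by (simp add: euclidean_product_topology)
  have O: "closed ?O"
    by (intro closed_INT ballI closed_Collect_le continuous_on_product_coordinates)
  have S: "closed ?S"
    by (intro closed_Int closed_Collect_eq continuous_intros) auto
  have "compact (?B \<inter> (?O \<inter> ?S))"
    by (rule compact_Int_closed[OF B closed_Int[OF O S]])
  moreover have "?K = ?B \<inter> (?O \<inter> ?S)"
  proof (intro set_eqI iffI IntI)
    fix v
    assume v: "v \<in> ?K"
    have "\<bar>v i\<bar> \<le> 1" if "i \<in> {1..n}" for i
      using member_le_sum[of i "{1..n}" "\<lambda>i. (v i)\<^sup>2"] that v by (simp add: abs_square_le_1)
    then have "v i \<in> {-1..1}" if "i \<in> {1..n}" for i
      using that by (simp add: abs_le_iff minus_le_iff)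
    then show "v \<in> ?B"
      using v by (simp add: ordered_zero_sum_def extensional_def PiE_iff)
    show "v \<in> ?O"
      using v by (auto simp: ordered_zero_sum_def mono_on_def)
    show "v \<in> {v. (\<Sum>i = 1..n. v i) = 0}" "v \<in> {v. (\<Sum>i = 1..n. (v i)\<^sup>2) = 1}"
      using v by (auto simp: ordered_zero_sum_def)
  next
    fix v
    assume v: "v \<in> ?B \<inter> (?O \<inter> ?S)"
    have "v i = undefined" if "i \<notin> {1..n}" for i
      using PiE_mem[OF IntD1[OF v], of i] that by (auto split: if_splits)
    then have "v \<in> extensional {1..n}"
      by (simp add: extensional_def)
    moreover have "mono_on {1..n} v"
      using v by (auto simp: mono_on_def)
    ultimately show "v \<in> ?K"
      using v by (simp add: ordered_zero_sum_def)
  qed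
  ultimately show ?thesis
    by (simp only:)
qed

text \<open>On the compact unit sphere \<open>U\<close> has a positive minimum and a maximum;
  homogeneity carries these to every radius. The exponent is \<open>p / 2\<close> because the sum of
  squares is the squared radius.\<close>

lemma feasible_definite_bounds:
  assumes "feasible_definite n p U"
  shows "\<exists>c C. 0 < c \<and> 0 < C \<and> (\<forall>v \<in> ordered_zero_sum n.
    c * (\<Sum>i = 1..n. (v i)\<^sup>2) powr (p / 2) \<le> U v \<and> U v \<le> C * (\<Sum>i = 1..n. (v i)\<^sup>2) powr (p / 2))"
proof -
  let ?K = "{v \<in> ordered_zero_sum n. (\<Sum>i = 1..n. (v i)\<^sup>2) = 1}"
  have p: "p > 0"
    and nonneg: "\<And>v. v \<in> ordered_zero_sum n \<Longrightarrow> 0 \<le> U v"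
    and cont: "continuous_on (ordered_zero_sum n) U"
    and zero: "\<And>v. v \<in> ordered_zero_sum n \<Longrightarrow> U v = 0 \<longleftrightarrow> (\<forall>i \<in> {1..n}. v i = 0)"
    and hom: "\<And>s v. s > 0 \<Longrightarrow> v \<in> ordered_zero_sum n \<Longrightarrow> U (\<lambda>i \<in> {1..n}. s * v i) = s powr p * U v"
    using assms unfolding feasible_definite_def by blast+
  have contK: "continuous_on ?K U"
    by (rule continuous_on_subset[OF cont]) auto
  have posK: "0 < U v" if "v \<in> ?K" for v
  proof -
    have "\<not> (\<forall>i \<in> {1..n}. v i = 0)"
    proof
      assume "\<forall>i \<in> {1..n}. v i = 0"
      then have "(\<Sum>i = 1..n. (v i)\<^sup>2) = 0"
        by simp
      with that show False
        by simp
    qed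
    then show ?thesis
      using that nonneg[of v] zero[of v] by force
  qed
  have "\<exists>c C. 0 < c \<and> 0 < C \<and> (\<forall>v \<in> ?K. c \<le> U v \<and> U v \<le> C)"
  proof (cases "?K = {}")
    \<comment> \<open>The sphere is empty for \<open>n \<le> 1\<close>; any positive constants then
      do.\<close>
    case True
    then show ?thesis
      by (intro exI[of _ 1]) auto
  next
    case False
    obtain v0 v1 where v: "v0 \<in> ?K" "\<forall>v \<in> ?K. U v0 \<le> U v" "v1 \<in> ?K" "\<forall>v \<in> ?K. U v \<le> U v1"
      using continuous_attains_inf[OF compact_ordered_zero_sum_sphere False contK]
        continuous_attains_sup[OF compact_ordered_zero_sum_sphere False contK] by blast
    then show ?thesis
      using posK[OF v(1)] posK[OF v(3)] by blast
  qed
  then obtain c C where c: "0 < c" "0 < C" "\<And>v. v \<in> ?K \<Longrightarrow> c \<le> U v \<and> U v \<le> C"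
    by blast
  have "c * (\<Sum>i = 1..n. (v i)\<^sup>2) powr (p / 2) \<le> U v \<and> U v \<le> C * (\<Sum>i = 1..n. (v i)\<^sup>2) powr (p / 2)"
    if v: "v \<in> ordered_zero_sum n" for v
  proof (cases "\<forall>i \<in> {1..n}. v i = 0")
    case True
    then show ?thesis
      using zero[OF v] p by simp
  next
    case False
    define r where "r = sqrt (\<Sum>i = 1..n. (v i)\<^sup>2)"
    have "(\<Sum>i = 1..n. (v i)\<^sup>2) \<noteq> 0"
      using False by (simp add: sum_nonneg_eq_0_iff)
    then have sq: "(\<Sum>i = 1..n. (v i)\<^sup>2) = r\<^sup>2" and r: "r > 0"
      by (auto simp: r_def sum_nonneg less_le)
    define u where "u = (\<lambda>i \<in> {1..n}. 1 / r * v i)"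
    have "(\<Sum>i = 1..n. u i) = 1 / r * (\<Sum>i = 1..n. v i)"
      by (simp add: u_def sum_distrib_left)
    moreover have "(\<Sum>i = 1..n. (u i)\<^sup>2) = (1 / r)\<^sup>2 * (\<Sum>i = 1..n. (v i)\<^sup>2)"
      unfolding sum_distrib_left by (intro sum.cong) (auto simp: u_def power_divide)
    ultimately have u: "u \<in> ?K"
      using v r unfolding sq
      by (auto simp: ordered_zero_sum_def u_def mono_on_def power_divide divide_right_mono)
    have "U u = (1 / r) powr p * U v"
      unfolding u_def using r by (intro hom v) auto
    then have "U v = r powr p * U u"
      using r by (simp add: powr_divide)
    moreover have "(\<Sum>i = 1..n. (v i)\<^sup>2) powr (p / 2) = r powr p"
      unfolding sq using r by (simp add: powr_powr flip: powr_numeral)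
    ultimately show ?thesis
      using c(3)[OF u] r by simp
  qed
  then show ?thesis
    using c(1,2) by blast
qed

section \<open>Transfer from an abstract probability space to the law of the sample\<close>

theorem mainTheorem1:
  fixes M :: "'a measure" and X :: "nat \<Rightarrow> 'a \<Rightarrow> real" and F :: "real measure"
    and f :: "real \<Rightarrow> real" and U :: "(nat \<Rightarrow> real) \<Rightarrow> real" and n :: nat and p :: real
  assumes "n \<ge> 3"
    and "prob_space M"
    and "prob_space.indep_vars M (\<lambda>_. borel) X {1..n}"
    and "\<And>i. i \<in> {1..n} \<Longrightarrow> distr M borel (X i) = F"
    and "F = density lborel (\<lambda>x. ennreal (f x))"
    and "\<And>x. f x > 0"
    and "continuous_on UNIV f"
    and "p > 0"
    and "feasible_definite n p U"
  shows "prob_space.indep_var M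
           borel (\<lambda>\<omega>. sample_mean n (\<lambda>i. X i \<omega>))
           borel (\<lambda>\<omega>. base_statistic n U (\<lambda>i. X i \<omega>))
         \<longleftrightarrow> is_normal_distribution F"
proof -
  interpret prob_space M
    by (rule assms(2))
  note indep = assms(3) and F = assms(4) and f_pos = assms(6) and feas = assms(9)
  have n: "n > 0" "n \<ge> 2" "{1..n} \<noteq> {}"
    using assms(1) by auto
  have X [measurable]: "X i \<in> borel_measurable M" if "i \<in> {1..n}" for i
    using indep that by (simp add: indep_vars_def)
  have F_prob: "prob_space F"
    using prob_space_distr[OF X, of 1] F[of 1] n by simp
  have f_meas: "f \<in> borel_measurable borel"
    by (rule borel_measurable_continuous_onI[OF assms(7)])
  define V where "V \<omega> = (\<lambda>i\<in>{1..n}. X i \<omega>)" for \<omega>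
  have V: "V \<in> M \<rightarrow>\<^sub>M PiM {1..n} (\<lambda>_. borel)"
    unfolding V_def[abs_def] by (intro measurable_restrict X)
  have "distr M (PiM {1..n} (\<lambda>_. borel)) V = PiM {1..n} (\<lambda>i. distr M borel (X i))"
    using indep unfolding V_def[abs_def] by (subst (asm) indep_vars_iff_distr_eq_PiM'[OF n(3) X]) auto
  also have "\<dots> = PiM {1..n} (\<lambda>_. F)"
    by (intro PiM_cong F) auto
  also have PiM_F: "\<dots> = iid_sample n f"
    unfolding assms(5) by (rule PiM_density_eq_iid_sample[OF f_meas f_pos F_prob[unfolded assms(5)]])
  finally have law: "distr M (PiM {1..n} (\<lambda>_. borel)) V = iid_sample n f" .
  have iid_prob: "prob_space (iid_sample n f)"
    unfolding law[symmetric] by (rule prob_space_distr[OF V])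
  note Z = base_statistic_measurable[OF n(1) feas]
  have "indep_var borel (\<lambda>\<omega>. sample_mean n (V \<omega>)) borel (\<lambda>\<omega>. base_statistic n U (V \<omega>))
      \<longleftrightarrow> prob_space.indep_var (iid_sample n f) borel (sample_mean n) borel (base_statistic n U)"
    unfolding law[symmetric] by (rule indep_var_distr_comp[OF V sample_mean_measurable Z])
  then have iff: "indep_var borel (\<lambda>\<omega>. sample_mean n (\<lambda>i. X i \<omega>)) borel (\<lambda>\<omega>. base_statistic n U (\<lambda>i. X i \<omega>))
      \<longleftrightarrow> prob_space.indep_var (iid_sample n f) borel (sample_mean n) borel (base_statistic n U)"
    by (simp only: V_def base_statistic_restrict sample_mean_restrict)
  show ?thesis
    unfolding iff
  proof
    assume "is_normal_distribution F"
    then obtain \<mu> \<sigma> where \<sigma>: "\<sigma> > 0" and "F = density lborel (\<lambda>x. ennreal (normal_density \<mu> \<sigma> x))"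
      unfolding is_normal_distribution_def by blast
    \<comment> \<open>Normality equates measures, not the functions \<open>f\<close> and
      \<open>normal_density \<mu> \<sigma>\<close>, so the two sample laws are identified through
      the product of copies of \<open>F\<close>.\<close>
    then have "PiM {1..n} (\<lambda>_. F) = iid_sample n (normal_density \<mu> \<sigma>)"
      using F_prob by (simp add: PiM_density_eq_iid_sample normal_density_pos)
    then have eq: "iid_sample n f = iid_sample n (normal_density \<mu> \<sigma>)"
      using PiM_F by simp
    show "prob_space.indep_var (iid_sample n f) borel (sample_mean n) borel (base_statistic n U)"
      using iid_prob unfolding eq
      by (rule indep_mean_if_normal[OF n(1) \<sigma> _ Z]) (rule base_statistic_translate[OF n(1)])
  next
    assume ind: "prob_space.indep_var (iid_sample n f) borel (sample_mean n) borel (base_statistic n U)"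
    obtain c C where c: "0 < c" "0 < C" and bounds: "\<And>v. v \<in> ordered_zero_sum n \<Longrightarrow>
        c * (\<Sum>i = 1..n. (v i)\<^sup>2) powr (p / 2) \<le> U v \<and> U v \<le> C * (\<Sum>i = 1..n. (v i)\<^sup>2) powr (p / 2)"
      using feasible_definite_bounds[OF feas] by blast
    interpret iid: indep_shift_statistic n f "base_statistic n U" c C "p / 2"
    proof (rule indep_shift_statistic.intro)
      fix x
      show "c * sq_dev n x powr (p / 2) \<le> base_statistic n U x"
        "base_statistic n U x \<le> C * sq_dev n x powr (p / 2)"
        using bounds[OF sorted_dev_in[OF n(1), of x]] unfolding sum_sorted_dev_sq base_statistic_eq by auto
    qed (use n(2) f_pos assms(7,8) iid_prob Z base_statistic_translate[OF n(1)] c ind in \<open>simp_all only: half_gt_zero\<close>)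
    show "is_normal_distribution F"
      using F_prob unfolding assms(5) by (rule iid.is_normal)
  qed
qed

end
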